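(* Let $k\ge 2$ and $n\ge 1$ be integers. A bounded linear operator $\mathcal{S}$ on $L^2(\mathbb{T}^n)$ is a $k^{th}$ order slant Hankel operator if and only if $$\langle \mathcal{S}\,e_{m-k\varepsilon_j},\,e_{m'+\varepsilon_j}\rangle=\langle \mathcal{S}\,e_m,\,e_{m'}\rangle\quad\text{for all } m,m'\in\mathbb{Z}^n \text{ and all } 1\le j\le n.$$
   Context: $\mathbb{T}^n$ is the $n$-torus with normalized Haar measure; $e_m(z)=z^m=z_1^{m_1}\cdots z_n^{m_n}$ for $m\in\mathbb{Z}^n$, an orthonormal basis of $L^2(\mathbb{T}^n)$; $\varepsilon_j$ is the $j$-th standard unit vector of $\mathbb{Z}^n$. For $m\in\mathbb{Z}^n$, $k\mid m$ means $k$ divides every component of $m$. Let $\mathcal{V}_k^n$ be the bounded linear operator on $L^2(\mathbb{T}^n)$ with $\mathcal{V}_k^n e_m=e_{-m/k}$ if $k\mid m$ and $\mathcal{V}_k^n e_m=0$ otherwise. For $\phi\in L^\infty(\mathbb{T}^n)$, $M_\phi$ is multiplication by $\phi$ and $\mathcal{S}_\phi^{k,n}=\mathcal{V}_k^nM_\phi$. A $k^{th}$ order slant Hankel operator on $L^2(\mathbb{T}^n)$ is an operator of the form $\mathcal{S}_\phi^{k,n}$ for some $\phi\in L^\infty(\mathbb{T}^n)$. *)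

theory Defs
  imports "HOL-Probability.Probability"
begin

text \<open>
  The dimension is \<open>n = CARD('n)\<close>, so \<open>n \<ge> 1\<close> holds automatically. Haar measure is the image of
  Lebesgue measure on the unit cube under \<open>t \<mapsto> (exp (2 \<pi> i t\<^sub>j))\<^sub>j\<close>; its underlying space is
  exactly the torus, so values of functions outside the torus are irrelevant almost everywhere.
\<close>

definition torus :: "(complex ^ 'n::finite) set" where
  "torus = {z. \<forall>j. norm (z $ j) = 1}"

definition haar :: "(complex ^ 'n::finite) measure" where
  "haar = distr (uniform_measure lborel (cbox 0 1)) (restrict_space borel torus)
            (\<lambda>t::real ^ 'n. \<chi> j. cis (2 * pi * t $ j))"

lemma space_haar [simp]: "space haar = torus"
  by (simp add: haar_def space_restrict_space)

lemma sets_haar: "sets haar = sets (restrict_space borel torus)"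
  by (simp add: haar_def)

lemma measurable_torus_param [measurable]:
  "(\<lambda>t::real ^ 'n::finite. \<chi> j. cis (2 * pi * t $ j))
     \<in> uniform_measure lborel (cbox 0 1) \<rightarrow>\<^sub>M restrict_space borel torus"
proof (rule measurable_restrict_space2)
  show "(\<lambda>t::real ^ 'n. \<chi> j. cis (2 * pi * t $ j)) \<in> space (uniform_measure lborel (cbox 0 1)) \<rightarrow> torus"
    by (simp add: torus_def)
  have "continuous_on UNIV (\<lambda>t::real ^ 'n. \<chi> j. cis (2 * pi * t $ j))"
    by (intro continuous_intros)
  then have "(\<lambda>t::real ^ 'n. \<chi> j. cis (2 * pi * t $ j)) \<in> borel_measurable borel"
    by (rule borel_measurable_continuous_onI)
  then show "(\<lambda>t::real ^ 'n. \<chi> j. cis (2 * pi * t $ j))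
      \<in> borel_measurable (uniform_measure lborel (cbox 0 1))"
    by (simp add: measurable_def)
qed

lemma prob_space_haar: "prob_space (haar :: (complex ^ 'n::finite) measure)"
proof -
  have one: "emeasure lborel (cbox 0 (1::real ^ 'n)) = 1"
    by (subst emeasure_lborel_cbox) (auto simp: Basis_vec_def inner_axis intro!: prod.neutral)
  have "prob_space (uniform_measure lborel (cbox 0 (1::real ^ 'n)))"
    by (rule prob_space_uniform_measure) (simp_all only: one, simp_all)
  then show ?thesis
    unfolding haar_def by (rule prob_space.prob_space_distr) (rule measurable_torus_param)
qed

interpretation haar: prob_space haar
  by (rule prob_space_haar)

definition sq_integrable :: "(complex ^ 'n::finite \<Rightarrow> complex) \<Rightarrow> bool" where
  "sq_integrable f \<longleftrightarrow> f \<in> borel_measurable haar \<and> integrable haar (\<lambda>z. (norm (f z))\<^sup>2)"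

definition L2_eq :: "(complex ^ 'n::finite \<Rightarrow> complex) \<Rightarrow> (complex ^ 'n \<Rightarrow> complex) \<Rightarrow> bool" where
  "L2_eq f g \<longleftrightarrow> sq_integrable f \<and> sq_integrable g \<and> (AE z in haar. f z = g z)"

lemma sq_integrable_measurable: "sq_integrable f \<Longrightarrow> f \<in> borel_measurable haar"
  by (simp add: sq_integrable_def)

lemma sq_integrable_bounded_mult:
  assumes f: "sq_integrable f" and [measurable]: "\<phi> \<in> borel_measurable haar"
    and C: "AE z in haar. norm (\<phi> z) \<le> C"
  shows "sq_integrable (\<lambda>z. \<phi> z * f z)"
proof -
  have [measurable]: "f \<in> borel_measurable haar" and i: "integrable haar (\<lambda>z. (norm (f z))\<^sup>2)"
    using f by (auto simp: sq_integrable_def)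
  have "integrable haar (\<lambda>z. (norm (\<phi> z * f z))\<^sup>2)"
  proof (rule Bochner_Integration.integrable_bound)
    show "integrable haar (\<lambda>z. C\<^sup>2 * (norm (f z))\<^sup>2)"
      using i by simp
    show "AE z in haar. norm ((norm (\<phi> z * f z))\<^sup>2) \<le> norm (C\<^sup>2 * (norm (f z))\<^sup>2)"
      using C by eventually_elim
        (auto simp: norm_mult power_mult_distrib intro!: mult_right_mono power_mono)
  qed measurable
  then show ?thesis by (simp add: sq_integrable_def)
qed

lemma sq_integrable_add:
  assumes "sq_integrable f" "sq_integrable g"
  shows "sq_integrable (\<lambda>z. f z + g z)"
proof -
  have [measurable]: "f \<in> borel_measurable haar" "g \<in> borel_measurable haar"
    and i: "integrable haar (\<lambda>z. (norm (f z))\<^sup>2)" "integrable haar (\<lambda>z. (norm (g z))\<^sup>2)"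
    using assms by (auto simp: sq_integrable_def)
  have le: "(norm (a + b))\<^sup>2 \<le> 2 * (norm a)\<^sup>2 + 2 * (norm b)\<^sup>2" for a b :: complex
  proof -
    have "(norm (a + b))\<^sup>2 \<le> (norm a + norm b)\<^sup>2"
      by (intro power_mono norm_triangle_ineq) simp
    also have "\<dots> \<le> 2 * (norm a)\<^sup>2 + 2 * (norm b)\<^sup>2"
      using sum_squares_bound[of "norm a" "norm b"] by (simp add: power2_sum)
    finally show ?thesis .
  qed
  have "integrable haar (\<lambda>z. (norm (f z + g z))\<^sup>2)"
  proof (rule Bochner_Integration.integrable_bound)
    show "integrable haar (\<lambda>z. 2 * (norm (f z))\<^sup>2 + 2 * (norm (g z))\<^sup>2)"
      using i by simp
    show "AE z in haar. norm ((norm (f z + g z))\<^sup>2) \<le> norm (2 * (norm (f z))\<^sup>2 + 2 * (norm (g z))\<^sup>2)"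
      using le by auto
  qed measurable
  then show ?thesis by (simp add: sq_integrable_def)
qed

lemma sq_integrable_cmult: "sq_integrable f \<Longrightarrow> sq_integrable (\<lambda>z. c * f z)"
  by (rule sq_integrable_bounded_mult[where C = "norm c"]) auto

lemma sq_integrable_zero: "sq_integrable (\<lambda>_. 0)"
  by (simp add: sq_integrable_def)

lemma sq_integrable_integrable_mult:
  assumes "sq_integrable f" "sq_integrable g"
  shows "integrable haar (\<lambda>z. f z * cnj (g z))"
proof -
  have [measurable]: "f \<in> borel_measurable haar" "g \<in> borel_measurable haar"
    and i: "integrable haar (\<lambda>z. (norm (f z))\<^sup>2)" "integrable haar (\<lambda>z. (norm (g z))\<^sup>2)"
    using assms by (auto simp: sq_integrable_def)
  have le: "norm a * norm b \<le> (norm a)\<^sup>2 + (norm b)\<^sup>2" for a b :: complex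
    using sum_squares_bound[of "norm a" "norm b"] mult_nonneg_nonneg[OF norm_ge_zero norm_ge_zero, of a b]
    by linarith
  have [measurable]: "(\<lambda>z. cnj (g z)) \<in> borel_measurable haar"
    by (rule borel_measurable_continuous_on[OF continuous_on_cnj[OF continuous_on_id]]) measurable
  show ?thesis
  proof (rule Bochner_Integration.integrable_bound)
    show "integrable haar (\<lambda>z. (norm (f z))\<^sup>2 + (norm (g z))\<^sup>2)"
      using i by simp
    show "AE z in haar. norm (f z * cnj (g z)) \<le> norm ((norm (f z))\<^sup>2 + (norm (g z))\<^sup>2)"
      using le by (auto simp: norm_mult)
  qed measurable
qed

quotient_type (overloaded) 'n torus_L2 = "complex ^ 'n::finite \<Rightarrow> complex" / partial: L2_eq
proof (rule part_equivpI)
  show "\<exists>f::complex ^ 'n \<Rightarrow> complex. L2_eq f f"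
    by (rule exI[of _ "\<lambda>_. 0"]) (simp add: L2_eq_def sq_integrable_zero)
  show "symp L2_eq"
    by (auto simp: symp_def L2_eq_def eq_commute)
  show "transp L2_eq"
    by (auto simp: transp_def L2_eq_def)
qed

lift_definition L2_cinner :: "'n::finite torus_L2 \<Rightarrow> 'n torus_L2 \<Rightarrow> complex"
  is "\<lambda>f g. \<integral>z. f z * cnj (g z) \<partial>haar"
proof -
  fix f f' g g' :: "complex ^ 'n \<Rightarrow> complex"
  assume a: "L2_eq f f'" "L2_eq g g'"
  have "AE z in haar. f z * cnj (g z) = f' z * cnj (g' z)"
    using a unfolding L2_eq_def by auto
  moreover have "integrable haar (\<lambda>z. f z * cnj (g z))" "integrable haar (\<lambda>z. f' z * cnj (g' z))"
    using a by (auto simp: L2_eq_def intro!: sq_integrable_integrable_mult)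
  ultimately show "(\<integral>z. f z * cnj (g z) \<partial>haar) = (\<integral>z. f' z * cnj (g' z) \<partial>haar)"
    by (intro integral_cong_AE) auto
qed

lift_definition L2_scaleC :: "complex \<Rightarrow> 'n::finite torus_L2 \<Rightarrow> 'n torus_L2"
  is "\<lambda>c f z. c * f z"
  by (auto simp: L2_eq_def intro: sq_integrable_cmult)

instantiation torus_L2 :: (finite) real_inner
begin

lift_definition zero_torus_L2 :: "'a torus_L2" is "\<lambda>_. 0"
  by (simp add: L2_eq_def sq_integrable_zero)

lift_definition plus_torus_L2 :: "'a torus_L2 \<Rightarrow> 'a torus_L2 \<Rightarrow> 'a torus_L2"
  is "\<lambda>f g z. f z + g z"
  by (auto simp: L2_eq_def intro: sq_integrable_add)

lift_definition uminus_torus_L2 :: "'a torus_L2 \<Rightarrow> 'a torus_L2" is "\<lambda>f z. - f z"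
  using sq_integrable_cmult[of _ "-1"] by (auto simp: L2_eq_def)

definition minus_torus_L2 :: "'a torus_L2 \<Rightarrow> 'a torus_L2 \<Rightarrow> 'a torus_L2"
  where "f - g = f + - (g :: 'a torus_L2)"

definition scaleR_torus_L2 :: "real \<Rightarrow> 'a torus_L2 \<Rightarrow> 'a torus_L2"
  where "scaleR_torus_L2 r f = L2_scaleC (complex_of_real r) f"

text \<open>The real inner product of the class is the real part of the complex one, so that the
  class norm is the usual $L^2$ norm (\<open>norm_torus_L2_eq\<close> below).\<close>

definition inner_torus_L2 :: "'a torus_L2 \<Rightarrow> 'a torus_L2 \<Rightarrow> real"
  where "inner_torus_L2 f g = Re (L2_cinner f g)"

definition norm_torus_L2 :: "'a torus_L2 \<Rightarrow> real"
  where "norm_torus_L2 f = sqrt (inner f f)"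

definition dist_torus_L2 :: "'a torus_L2 \<Rightarrow> 'a torus_L2 \<Rightarrow> real"
  where "dist_torus_L2 f g = norm (f - g)"

definition sgn_torus_L2 :: "'a torus_L2 \<Rightarrow> 'a torus_L2"
  where "sgn_torus_L2 f = inverse (norm f) *\<^sub>R f"

definition uniformity_torus_L2 :: "('a torus_L2 \<times> 'a torus_L2) filter"
  where "uniformity_torus_L2 = (INF e\<in>{0 <..}. principal {(x, y). dist x y < e})"

definition open_torus_L2 :: "'a torus_L2 set \<Rightarrow> bool"
  where "open_torus_L2 U \<longleftrightarrow> (\<forall>x\<in>U. eventually (\<lambda>(x', y). x' = x \<longrightarrow> y \<in> U) uniformity)"

instance
proof
  fix f g h :: "'a torus_L2" and a b :: real
  show "f + g + h = f + (g + h)"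
    by transfer (auto simp: L2_eq_def add.assoc intro!: sq_integrable_add)
  show "f + g = g + f"
    by transfer (auto simp: L2_eq_def add.commute intro!: sq_integrable_add)
  show "0 + f = f"
    by transfer (auto simp: L2_eq_def)
  show "- f + f = 0"
    by transfer (auto simp: L2_eq_def sq_integrable_zero)
  show "f - g = f + - g"
    by (rule minus_torus_L2_def)
  show "a *\<^sub>R (f + g) = a *\<^sub>R f + a *\<^sub>R g"
    unfolding scaleR_torus_L2_def
    by transfer (auto simp: L2_eq_def distrib_left intro!: sq_integrable_add sq_integrable_cmult)
  show "(a + b) *\<^sub>R f = a *\<^sub>R f + b *\<^sub>R f"
    unfolding scaleR_torus_L2_def
    by transfer (auto simp: L2_eq_def distrib_right intro!: sq_integrable_add sq_integrable_cmult)
  show "a *\<^sub>R b *\<^sub>R f = (a * b) *\<^sub>R f"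
    unfolding scaleR_torus_L2_def
    by transfer (auto simp: L2_eq_def mult.assoc intro!: sq_integrable_cmult)
  show "1 *\<^sub>R f = f"
    unfolding scaleR_torus_L2_def by transfer (auto simp: L2_eq_def)
  show "sgn f = inverse (norm f) *\<^sub>R f"
    by (rule sgn_torus_L2_def)
  show "dist f g = norm (f - g)"
    by (rule dist_torus_L2_def)
  show "(uniformity :: ('a torus_L2 \<times> 'a torus_L2) filter) = (INF e\<in>{0 <..}. principal {(x, y). dist x y < e})"
    by (rule uniformity_torus_L2_def)
  show "open U \<longleftrightarrow> (\<forall>x\<in>U. eventually (\<lambda>(x', y). x' = x \<longrightarrow> y \<in> U) uniformity)"
    for U :: "'a torus_L2 set"
    by (rule open_torus_L2_def)
  show "norm f = sqrt (inner f f)"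
    by (rule norm_torus_L2_def)
  show "inner f g = inner g f"
    unfolding inner_torus_L2_def
  proof transfer
    fix f g :: "complex ^ 'a \<Rightarrow> complex"
    assume "L2_eq f f" "L2_eq g g"
    then have "integrable haar (\<lambda>z. f z * cnj (g z))" "integrable haar (\<lambda>z. g z * cnj (f z))"
      by (auto simp: L2_eq_def intro!: sq_integrable_integrable_mult)
    then show "Re (\<integral>z. f z * cnj (g z) \<partial>haar) = Re (\<integral>z. g z * cnj (f z) \<partial>haar)"
      by (simp flip: integral_Re add: mult.commute)
  qed
  show "inner (f + g) h = inner f h + inner g h"
    unfolding inner_torus_L2_def
  proof transfer
    fix f g h :: "complex ^ 'a \<Rightarrow> complex"
    assume "L2_eq f f" "L2_eq g g" "L2_eq h h"
    then have "integrable haar (\<lambda>z. f z * cnj (h z))" "integrable haar (\<lambda>z. g z * cnj (h z))"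
      by (auto simp: L2_eq_def intro!: sq_integrable_integrable_mult)
    then show "Re (\<integral>z. (f z + g z) * cnj (h z) \<partial>haar)
        = Re (\<integral>z. f z * cnj (h z) \<partial>haar) + Re (\<integral>z. g z * cnj (h z) \<partial>haar)"
      by (simp add: distrib_right)
  qed
  show "inner (a *\<^sub>R f) g = a * inner f g"
    unfolding inner_torus_L2_def scaleR_torus_L2_def
    by transfer (simp add: mult.assoc)
  have sq: "(\<integral>z. f z * cnj (f z) \<partial>haar) = complex_of_real (\<integral>z. (norm (f z))\<^sup>2 \<partial>haar)"
    for f :: "complex ^ 'a \<Rightarrow> complex"
    by (simp add: complex_norm_square[symmetric] del: of_real_power)
  show "0 \<le> inner f f"
    unfolding inner_torus_L2_def by transfer (simp add: sq)
  show "inner f f = 0 \<longleftrightarrow> f = 0"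
    unfolding inner_torus_L2_def
  proof transfer
    fix f :: "complex ^ 'a \<Rightarrow> complex"
    assume "L2_eq f f"
    then have "sq_integrable f" by (simp add: L2_eq_def)
    moreover from this have "integrable haar (\<lambda>z. (norm (f z))\<^sup>2)"
      by (simp add: sq_integrable_def)
    ultimately show "Re (\<integral>z. f z * cnj (f z) \<partial>haar) = 0 \<longleftrightarrow> L2_eq f (\<lambda>_. 0)"
      by (simp add: sq L2_eq_def sq_integrable_zero integral_nonneg_eq_0_iff_AE)
  qed
qed

end

lemma norm_torus_L2_eq:
  "sq_integrable f \<Longrightarrow> norm (abs_torus_L2 f) = sqrt (\<integral>z. (norm (f z))\<^sup>2 \<partial>haar)"
  by (simp add: norm_torus_L2_def inner_torus_L2_def L2_cinner.abs_eq L2_eq_def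
      complex_norm_square[symmetric] del: of_real_power)

definition bounded_clinear_L2 :: "('n::finite torus_L2 \<Rightarrow> 'n torus_L2) \<Rightarrow> bool" where
  "bounded_clinear_L2 T \<longleftrightarrow> bounded_linear T \<and> (\<forall>c f. T (L2_scaleC c f) = L2_scaleC c (T f))"

lift_definition ebasis :: "int ^ 'n::finite \<Rightarrow> 'n torus_L2"
  is "\<lambda>m z. \<Prod>j\<in>UNIV. z $ j powi m $ j"
proof -
  fix m :: "int ^ 'n"
  have "continuous_on torus (\<lambda>z::complex ^ 'n. \<Prod>j\<in>UNIV. z $ j powi m $ j)"
    by (intro continuous_intros) (auto simp: torus_def, metis norm_zero zero_neq_one)
  then have [measurable]: "(\<lambda>z::complex ^ 'n. \<Prod>j\<in>UNIV. z $ j powi m $ j) \<in> borel_measurable haar"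
    using borel_measurable_continuous_on_restrict measurable_cong_sets[OF sets_haar refl] by blast
  have "integrable haar (\<lambda>z::complex ^ 'n. (norm (\<Prod>j\<in>UNIV. z $ j powi m $ j))\<^sup>2)"
  proof (rule haar.integrable_const_bound[where B = 1])
    show "AE z in haar. norm ((norm (\<Prod>j\<in>UNIV. (z::complex ^ 'n) $ j powi m $ j))\<^sup>2) \<le> 1"
      by (auto simp: torus_def norm_power_int prod_norm[symmetric])
  qed measurable
  then show "L2_eq (\<lambda>z. \<Prod>j\<in>UNIV. z $ j powi m $ j) (\<lambda>z. \<Prod>j\<in>UNIV. z $ j powi m $ j)"
    by (simp add: L2_eq_def sq_integrable_def)
qed

definition Linf :: "(complex ^ 'n::finite \<Rightarrow> complex) set" where
  "Linf = {\<phi> \<in> borel_measurable haar. \<exists>C. AE z in haar. norm (\<phi> z) \<le> C}"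

text \<open>The operator is only meant for symbols in \<open>Linf\<close>; the value \<open>0\<close> elsewhere is a dummy.\<close>

lift_definition mult_op :: "(complex ^ 'n::finite \<Rightarrow> complex) \<Rightarrow> 'n torus_L2 \<Rightarrow> 'n torus_L2"
  is "\<lambda>\<phi> f. if \<phi> \<in> Linf then (\<lambda>z. \<phi> z * f z) else (\<lambda>_. 0)"
proof -
  fix \<phi> f g :: "complex ^ 'n \<Rightarrow> complex"
  assume fg: "L2_eq f g"
  show "L2_eq (if \<phi> \<in> Linf then (\<lambda>z. \<phi> z * f z) else (\<lambda>_. 0))
      (if \<phi> \<in> Linf then (\<lambda>z. \<phi> z * g z) else (\<lambda>_. 0))"
  proof (cases "\<phi> \<in> Linf")
    case True
    then obtain C where "\<phi> \<in> borel_measurable haar" "AE z in haar. norm (\<phi> z) \<le> C"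
      by (auto simp: Linf_def)
    with fg True show ?thesis
      by (auto simp: L2_eq_def intro: sq_integrable_bounded_mult)
  qed (simp add: L2_eq_def sq_integrable_zero)
qed

text \<open>The bounded operator is determined by its values on the orthonormal basis \<open>ebasis\<close>.\<close>

definition slant_V :: "int \<Rightarrow> 'n::finite torus_L2 \<Rightarrow> 'n torus_L2" where
  "slant_V k = (THE V. bounded_clinear_L2 V \<and>
     (\<forall>m. V (ebasis m) = (if \<forall>j. k dvd m $ j then ebasis (\<chi> j. - (m $ j div k)) else 0)))"

definition slant_hankel :: "int \<Rightarrow> (complex ^ 'n::finite \<Rightarrow> complex) \<Rightarrow> 'n torus_L2 \<Rightarrow> 'n torus_L2" where
  "slant_hankel k \<phi> = slant_V k \<circ> mult_op \<phi>"

definition is_slant_hankel :: "int \<Rightarrow> ('n::finite torus_L2 \<Rightarrow> 'n torus_L2) \<Rightarrow> bool" where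
  "is_slant_hankel k S \<longleftrightarrow> (\<exists>\<phi>\<in>Linf. S = slant_hankel k \<phi>)"

end

theory Submission
  imports Defs "HOL-Complex_Analysis.Cauchy_Integral_Theorem" "HOL-Library.Real_Mod"
begin

text \<open>
  Write \<open>p(z) = z\<^sup>-\<^sup>k\<close> coordinatewise. The operator \<open>V\<close> is averaging over the fibres of \<open>p\<close>, so
  \<open>V ((g \<circ> p) f) = g (V f)\<close>; with \<open>g\<close> a character this gives the relation for \<open>V M\<^sub>\<phi>\<close>.

  Conversely the relation says \<open>S ((g \<circ> p) f) = g (S f)\<close> for characters \<open>g\<close>. For a residue \<open>i\<close> modulo
  \<open>k\<close> put \<open>\<psi>\<^sub>i = S e\<^sub>i\<close>. By density the relation extends to indicators \<open>g = 1\<^sub>A\<close> with \<open>f = e\<^sub>i\<close>, and since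
  \<open>p\<close> preserves Haar measure, the \<open>L\<^sup>2\<close> norm of \<open>1\<^sub>A \<psi>\<^sub>i\<close> is at most \<open>\<parallel>S\<parallel>\<close> times that of \<open>1\<^sub>A\<close>, for all \<open>A\<close>.
  Hence \<open>\<psi>\<^sub>i\<close> is essentially bounded by \<open>\<parallel>S\<parallel>\<close>, and \<open>\<phi> = \<Sum>\<^sub>i e\<^sub>-\<^sub>i (\<psi>\<^sub>i \<circ> p)\<close> is a bounded symbol with \<open>V M\<^sub>\<phi> = S\<close>.
\<close>

section \<open>Characters of the torus\<close>

text \<open>The density step hides an obstacle: until \<open>\<psi>\<^sub>i\<close> is known to be
  bounded, multiplication by it is not a bounded operator, so no identity can be extended by
  continuity of that operator. It is extended one Fourier coefficient at a time. The product of a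
  character with the conjugate of \<open>\<psi>\<^sub>i\<close> lies in L^2, so pairing with it is
  continuous on L^2, and on characters this pairing gives the coefficients of S applied to
  \<open>e\<^sub>i (F \<circ> p)\<close>. The operator V is given by a definite description, so a
  bounded operator with the prescribed values has to be exhibited. The mean over the k^n points of a
  fibre is one, because the a-th powers of all k-th roots of unity sum to k or to 0. Explicit
  inverse roots have branch cuts, which makes a direct change of variables awkward. It is avoided by
  showing that a finite measure on the torus is determined by its Fourier coefficients: that p
  preserves Haar measure, and that a uniformly random inverse root of a Haar point is again Haar
  distributed, then become computations with characters.\<close>

definition torus_char :: "int ^ 'n::finite \<Rightarrow> complex ^ 'n \<Rightarrow> complex" where
  "torus_char m z = (\<Prod>j\<in>UNIV. z $ j powi m $ j)"

lemma torus_nth_nonzero: "z \<in> torus \<Longrightarrow> z $ j \<noteq> 0"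
  by (auto simp: torus_def) (metis norm_zero zero_neq_one)

lemma norm_torus_char [simp]: "z \<in> torus \<Longrightarrow> norm (torus_char m z) = 1"
  by (auto simp: torus_def torus_char_def norm_power_int prod_norm[symmetric])

lemma torus_char_0 [simp]: "torus_char 0 z = 1"
  by (simp add: torus_char_def)

lemma torus_char_add: "z \<in> torus \<Longrightarrow> torus_char (m + l) z = torus_char m z * torus_char l z"
  by (simp add: torus_char_def torus_nth_nonzero power_int_add prod.distrib)

lemma continuous_on_torus_char: "continuous_on torus (torus_char m)"
  unfolding torus_char_def
  by (intro continuous_intros) (auto simp: torus_nth_nonzero)

lemma borel_measurable_haar_continuous:
  fixes f :: "complex ^ 'n::finite \<Rightarrow> 'b::topological_space"
  assumes "continuous_on torus f"
  shows "f \<in> borel_measurable haar"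
  using borel_measurable_continuous_on_restrict[OF assms] measurable_cong_sets[OF sets_haar refl] by blast

lemma borel_measurable_torus_char [measurable]: "torus_char m \<in> borel_measurable haar"
  by (rule borel_measurable_haar_continuous[OF continuous_on_torus_char])

lemma integral_cis_unit_interval:
  "(\<integral>x\<in>{0..1}. cis (2 * pi * of_int m * x) \<partial>lborel) = (if m = 0 then 1 else 0)"
proof (cases "m = 0")
  case False
  define c where "c = 2 * pi * real_of_int m"
  have c: "c \<noteq> 0" using False by (simp add: c_def)
  have "(LBINT x. indicator {0..1} x *\<^sub>R cis (c * x)) = (cis (c * 1) / (\<i> * c)) - (cis (c * 0) / (\<i> * c))"
  proof (rule integral_FTC_Icc)
    fix x :: real
    show "((\<lambda>x. cis (c * x) / (\<i> * c)) has_vector_derivative cis (c * x)) (at x within {0..1})"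
    proof -
      have "((\<lambda>w. exp (\<i> * c * w) / (\<i> * c)) has_field_derivative exp (\<i> * c * x)) (at (complex_of_real x))"
        using c by (auto intro!: derivative_eq_intros)
      from has_vector_derivative_real_field[OF this, of "{0..1}"] show ?thesis
        by (simp add: cis_conv_exp mult_ac)
    qed
  qed (auto intro!: continuous_intros)
  moreover have "cis c = 1" unfolding c_def using cis_multiple_2pi[of "of_int m"] by (simp add: mult_ac)
  ultimately show ?thesis using False by (simp add: set_lebesgue_integral_def c_def)
qed (simp add: set_lebesgue_integral_def)

text \<open>In cube coordinates a character is a product of one-variable functions, so Fubini leaves
  one integral \<open>integral_cis_unit_interval\<close> per coordinate.\<close>

lemma integral_torus_char:
  "(\<integral>z. torus_char m z \<partial>haar) = (if m = 0 then 1 else 0)"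
  for m :: "int ^ 'n::finite"
proof -
  have one: "emeasure lborel (cbox 0 (1::real ^ 'n)) = 1"
    by (subst emeasure_lborel_cbox) (auto simp: Basis_vec_def inner_axis intro!: prod.neutral)
  define g where "g j t = indicator {0..1} t *\<^sub>R cis (2 * pi * of_int (m $ j) * t)" for j and t :: real
  have inj: "inj_on (\<lambda>j. axis j (1::real) :: real ^ 'n) UNIV"
    by (auto simp: inj_on_def axis_eq_axis)
  have B: "Basis = range (\<lambda>j. axis j (1::real) :: real ^ 'n)"
    by (auto simp: Basis_vec_def)
  interpret P: product_sigma_finite "\<lambda>_::real^'n. lborel :: real measure" ..
  have gi: "integrable lborel (g j)" for j
    unfolding g_def set_integrable_def[symmetric]
    by (rule borel_integrable_atLeastAtMost') (auto intro!: continuous_intros)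
  have [measurable]: "g j \<in> borel_measurable borel" for j
    using borel_measurable_integrable[OF gi[of j]] by simp
  have [measurable]: "(\<lambda>x::real^'n. \<chi> j. cis (2 * pi * x $ j)) \<in> borel \<rightarrow>\<^sub>M restrict_space borel torus"
    using measurable_torus_param by (simp add: measurable_def)
  have [measurable]: "torus_char m \<in> borel_measurable (restrict_space borel torus)"
    by (rule borel_measurable_continuous_on_restrict[OF continuous_on_torus_char])
  have "(\<integral>z. torus_char m z \<partial>haar) = (\<integral>t. torus_char m (\<chi> j. cis (2 * pi * t $ j)) \<partial>uniform_measure lborel (cbox 0 1))"
    unfolding haar_def by (rule integral_distr) measurable
  also have "uniform_measure lborel (cbox 0 (1::real^'n)) = density lborel (\<lambda>x. ennreal (indicator (cbox 0 1) x))"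
    unfolding uniform_measure_def one
    by (auto intro!: arg_cong2[where f = density] simp: divide_ennreal_def indicator_def fun_eq_iff)
  also have "(\<integral>t. torus_char m (\<chi> j. cis (2 * pi * t $ j)) \<partial>density lborel (\<lambda>x. ennreal (indicator (cbox 0 1) x))) =
     (\<integral>t. indicator (cbox 0 1) t *\<^sub>R torus_char m (\<chi> j. cis (2 * pi * t $ j)) \<partial>lborel)"
    by (rule integral_density) auto
  also have "\<dots> = (\<integral>t. (\<Prod>j\<in>UNIV. g j (t $ j)) \<partial>(lborel :: (real^'n) measure))"
  proof (rule Bochner_Integration.integral_cong[OF refl])
    fix t :: "real ^ 'n"
    show "indicator (cbox 0 1) t *\<^sub>R torus_char m (\<chi> j. cis (2 * pi * t $ j)) = (\<Prod>j\<in>UNIV. g j (t $ j))"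
    proof (cases "t \<in> cbox 0 1")
      case True
      then show ?thesis
        by (auto simp: g_def torus_char_def cis_power_int mem_box_cart mult_ac intro!: prod.cong)
    next
      case False
      then obtain j where "t $ j \<notin> {0..1}" by (auto simp: mem_box_cart)
      then have "g j (t $ j) = 0" by (simp add: g_def)
      then have "(\<Prod>j\<in>UNIV. g j (t $ j)) = 0" by (intro prod_zero) auto
      then show ?thesis using False by simp
    qed
  qed
  \<comment> \<open>\<open>lborel_eq\<close> presents Lebesgue measure as the image of a product
    measure indexed by \<open>Basis\<close>; coordinate \<open>j\<close> of the image is the entry
    at \<open>axis j 1\<close>.\<close>
  also have "\<dots> = (\<integral>t. (\<Prod>j\<in>UNIV. g j (t (axis j 1))) \<partial>(\<Pi>\<^sub>M b\<in>(Basis :: (real^'n) set). lborel))"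
  proof (subst lborel_eq, subst integral_distr)
    show "(\<lambda>f. \<Sum>b\<in>Basis. f b *\<^sub>R b) \<in> (\<Pi>\<^sub>M b\<in>(Basis :: (real^'n) set). lborel) \<rightarrow>\<^sub>M borel" by measurable
    show "(\<lambda>t::real^'n. \<Prod>j\<in>UNIV. g j (t $ j)) \<in> borel_measurable borel" by measurable
    have "(\<Sum>b\<in>(Basis :: (real^'n) set). f b *\<^sub>R b) $ j = f (axis j 1)" for f and j :: 'n
      unfolding B by (subst sum.reindex[OF inj]) (simp add: axis_def if_distrib[of "(*) _"] cong: if_cong)
    then show "(\<integral>f. (\<Prod>j\<in>UNIV. g j ((\<Sum>b\<in>(Basis :: (real^'n) set). f b *\<^sub>R b) $ j)) \<partial>(\<Pi>\<^sub>M b\<in>(Basis :: (real^'n) set). lborel))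
      = (\<integral>t. (\<Prod>j\<in>UNIV. g j (t (axis j 1))) \<partial>(\<Pi>\<^sub>M b\<in>(Basis :: (real^'n) set). lborel))" by simp
  qed
  \<comment> \<open>The product rule wants the factors indexed by \<open>Basis\<close> as well; the
    description recovers \<open>j\<close> from \<open>axis j 1\<close>.\<close>
  also have "\<dots> = (\<integral>t. (\<Prod>b\<in>Basis. g (THE j. b = axis j 1) (t b)) \<partial>(\<Pi>\<^sub>M b\<in>(Basis :: (real^'n) set). lborel))"
    unfolding B by (subst prod.reindex[OF inj]) (simp add: axis_eq_axis)
  also have "\<dots> = (\<Prod>b\<in>(Basis::(real^'n) set). (\<integral>x. g (THE j. b = axis j 1) x \<partial>lborel))"
    by (rule P.product_integral_prod) (auto simp: gi)
  also have "\<dots> = (\<Prod>j\<in>UNIV. (\<integral>x. g j x \<partial>lborel))"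
    unfolding B by (subst prod.reindex[OF inj]) (simp add: axis_eq_axis)
  also have "\<dots> = (\<Prod>j\<in>UNIV. if m $ j = 0 then 1 else 0)"
    using integral_cis_unit_interval by (simp add: g_def set_lebesgue_integral_def)
  also have "\<dots> = (if m = 0 then 1 else 0)"
    by (auto simp: vec_eq_iff intro!: prod_zero)
  finally show ?thesis .
qed

section \<open>Trigonometric polynomials and uniqueness of Haar measure\<close>

text \<open>The rule \<open>cong\<close> makes this a property of the restriction to the torus.
  Products of characters are characters only where no coordinate vanishes, so closure under
  multiplication needs it.\<close>

inductive trig_poly :: "(complex ^ 'n::finite \<Rightarrow> complex) \<Rightarrow> bool" where
  char: "trig_poly (\<lambda>z. c * torus_char m z)"
| add: "trig_poly f \<Longrightarrow> trig_poly g \<Longrightarrow> trig_poly (\<lambda>z. f z + g z)"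
| cong: "trig_poly f \<Longrightarrow> (\<And>z. z \<in> torus \<Longrightarrow> g z = f z) \<Longrightarrow> trig_poly g"

lemma trig_poly_continuous: "trig_poly f \<Longrightarrow> continuous_on torus f"
proof (induction rule: trig_poly.induct)
  case (cong f g)
  then show ?case using continuous_on_cong by metis
qed (intro continuous_intros continuous_on_torus_char | assumption)+

lemma trig_poly_mult:
  assumes "trig_poly f" "trig_poly g" shows "trig_poly (\<lambda>z. f z * g z)"
  using assms
proof (induction arbitrary: g rule: trig_poly.induct)
  case (char c m)
  from char show ?case
  proof (induction rule: trig_poly.induct)
    case (char d l)
    show ?case by (rule trig_poly.cong[OF trig_poly.char[of "c * d" "m + l"]]) (simp add: torus_char_add)
  next
    case (add f g)
    then show ?case using trig_poly.add[OF add.IH] by (simp add: distrib_left)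
  next
    case (cong f g)
    then show ?case using trig_poly.cong[OF cong.IH] by simp
  qed
next
  case (add f h)
  then show ?case using trig_poly.add[OF add.IH(1)[OF add.prems] add.IH(2)[OF add.prems]] by (simp add: distrib_right)
next
  case (cong f h)
  then show ?case using trig_poly.cong[OF cong.IH[OF cong.prems]] by simp
qed

lemma trig_poly_const: "trig_poly (\<lambda>z. c)"
  using trig_poly.char[of c 0] by simp

lemma compact_torus: "compact (torus :: (complex ^ 'n::finite) set)"
proof -
  have "norm z \<le> real CARD('n)" if "z \<in> torus" for z :: "complex ^ 'n"
    using L2_set_le_sum[of UNIV "\<lambda>j. norm (z $ j)"] that by (simp add: norm_vec_def torus_def)
  then have "bounded (torus :: (complex ^ 'n) set)" by (auto simp: bounded_iff)
  moreover have "closed (torus :: (complex ^ 'n) set)"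
    unfolding torus_def by (intro closed_Collect_all closed_Collect_eq continuous_intros)
  ultimately show ?thesis by (simp add: compact_eq_bounded_closed)
qed

lemma torus_char_axis: "torus_char (of_int a *s axis j 1) z = z $ j powi a"
proof -
  have "torus_char (of_int a *s axis j 1) z = (\<Prod>i\<in>UNIV. if i = j then z $ j powi a else 1)"
    unfolding torus_char_def by (intro prod.cong) (auto simp: axis_def)
  then show ?thesis by simp
qed

lemma torus_inverse: "z \<in> torus \<Longrightarrow> inverse (z $ j) = cnj (z $ j)"
  by (simp add: torus_def inverse_complex.code complex_eq_iff cmod_power2[symmetric])

text \<open>Stone-Weierstrass is used in its real form, hence \<open>R\<close>: the real functions
  that become trigonometric polynomials when read as complex ones. \<open>R\<close> separates points
  because on the torus \<open>cnj (z $ j)\<close> is the inverse of \<open>z $ j\<close>, hence a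
  character, which puts the real and imaginary parts of each coordinate into
  \<open>R\<close>.\<close>

lemma trig_poly_dense:
  fixes g :: "complex ^ 'n::finite \<Rightarrow> real"
  assumes "continuous_on torus g" "e > 0"
  obtains p where "trig_poly p" "\<And>z. z \<in> torus \<Longrightarrow> norm (of_real (g z) - p z) < e"
proof -
  define R where "R = {h :: complex ^ 'n \<Rightarrow> real. trig_poly (\<lambda>z. of_real (h z))}"
  have coord: "trig_poly (\<lambda>z. c * z $ j)" "trig_poly (\<lambda>z. c * cnj (z $ j))" for c and j :: 'n
  proof -
    show "trig_poly (\<lambda>z. c * z $ j)"
      using trig_poly.char[of c "of_int 1 *s axis j 1"] unfolding torus_char_axis by simp
    show "trig_poly (\<lambda>z. c * cnj (z $ j))"
      by (rule trig_poly.cong[OF trig_poly.char[of c "of_int (- 1) *s axis j 1"]])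
        (simp only: torus_char_axis, simp add: power_int_minus torus_inverse)
  qed
  interpret function_ring_on R torus
  proof
    fix f h assume f: "f \<in> R"
    then have "continuous_on torus (\<lambda>z. Re (complex_of_real (f z)))"
      unfolding R_def by (intro continuous_on_Re trig_poly_continuous) auto
    then show "continuous_on torus f" by simp
    assume h: "h \<in> R"
    show "(\<lambda>x. f x + h x) \<in> R" "(\<lambda>x. f x * h x) \<in> R"
      using f h trig_poly.add trig_poly_mult by (fastforce simp: R_def)+
  next
    fix x y :: "complex ^ 'n" assume "x \<noteq> y"
    then obtain j where j: "x $ j \<noteq> y $ j" by (auto simp: vec_eq_iff)
    have "(\<lambda>z. Re (z $ j)) \<in> R"
      unfolding R_def mem_Collect_eq
      by (rule trig_poly.cong[OF trig_poly.add[OF coord(1)[of "1/2" j] coord(2)[of "1/2" j]]])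
        (simp add: complex_eq_iff)
    moreover have "(\<lambda>z. Im (z $ j)) \<in> R"
      unfolding R_def mem_Collect_eq
      by (rule trig_poly.cong[OF trig_poly.add[OF coord(1)[of "-\<i>/2" j] coord(2)[of "\<i>/2" j]]])
        (simp add: complex_eq_iff)
    ultimately show "\<exists>f\<in>R. f x \<noteq> f y" using j complex_eq_iff by metis
  qed (auto simp: compact_torus R_def trig_poly_const)
  obtain h where "h \<in> R" "\<And>z. z \<in> torus \<Longrightarrow> \<bar>g z - h z\<bar> < e"
    using Stone_Weierstrass_basic[OF assms] by auto
  then show ?thesis using that[of "\<lambda>z. of_real (h z)"]
    unfolding R_def by (auto simp flip: of_real_diff)
qed

section \<open>Finite measures on the torus and their Fourier coefficients\<close>

lemma closed_indicator_limit:
  fixes C :: "'a::metric_space set"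
  assumes "closed C"
  obtains g :: "nat \<Rightarrow> 'a \<Rightarrow> real"
  where "\<And>n. continuous_on UNIV (g n)" "\<And>n z. 0 \<le> g n z" "\<And>n z. g n z \<le> 1"
    "\<And>z. (\<lambda>n. g n z) \<longlonglongrightarrow> indicator C z"
proof (cases "C = {}")
  \<comment> \<open>The distance \<open>infdist\<close> to the empty set is 0 by convention, so the
    formula used below would converge to 1 here.\<close>
  case True
  then show ?thesis using that[of "\<lambda>_ _. 0"] by simp
next
  case False
  define g where "g n z = max 0 (1 - real n * infdist z C)" for n z
  show ?thesis
  proof (rule that[of g])
    show "continuous_on UNIV (g n)" for n
      unfolding g_def by (intro continuous_intros)
    show "0 \<le> g n z" "g n z \<le> 1" for n z
      by (simp_all add: g_def infdist_nonneg)
    show "(\<lambda>n. g n z) \<longlonglongrightarrow> indicator C z" for z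
    proof (cases "z \<in> C")
      case True
      then show ?thesis by (simp add: g_def)
    next
      case z: False
      then have d: "infdist z C > 0"
        using in_closed_iff_infdist_zero[OF assms False] infdist_nonneg[of z C] by force
      obtain N where N: "1 < real N * infdist z C" using reals_Archimedean3[OF d] by blast
      have "eventually (\<lambda>n. g n z = 0) sequentially"
        using eventually_ge_at_top[of N]
      proof eventually_elim
        case (elim n)
        then have "real N * infdist z C \<le> real n * infdist z C" using d by (intro mult_right_mono) auto
        then show ?case using N by (simp add: g_def)
      qed
      then show ?thesis using z by (simp add: tendsto_eventually)
    qed
  qed
qed

lemma sets_haar_closed:
  "sets (haar :: (complex ^ 'n::finite) measure) = sigma_sets torus ((\<inter>) torus ` Collect closed)"
proof -
  have "closed (torus :: (complex ^ 'n) set)" using compact_torus compact_imp_closed by blast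
  then have "(\<inter>) torus ` sigma_sets UNIV (Collect closed) = sigma_sets (torus :: (complex ^ 'n) set) ((\<inter>) torus ` Collect closed)"
    by (intro sigma_sets_Int) auto
  then show ?thesis
    by (simp add: sets_haar sets_restrict_space borel_eq_closed)
qed

lemma Int_stable_torus_closed: "Int_stable ((\<inter>) torus ` Collect closed)"
proof (rule Int_stableI_image)
  fix C D :: "(complex ^ 'n::finite) set"
  assume "C \<in> Collect closed" "D \<in> Collect closed"
  then show "\<exists>E\<in>Collect closed. torus \<inter> C \<inter> (torus \<inter> D) = torus \<inter> E"
    by (intro bexI[of _ "C \<inter> D"]) auto
qed

text \<open>Equality of integrals passes from characters to trigonometric polynomials, by uniform
  approximation to continuous functions, and by dominated convergence to closed sets, which form an
  intersection-stable generator.\<close>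

proposition haar_eqI:
  fixes N :: "(complex ^ 'n::finite) measure"
  assumes "finite_measure N" and sets: "sets N = sets haar"
    and char: "\<And>m. (\<integral>z. torus_char m z \<partial>N) = (\<integral>z. torus_char m z \<partial>haar)"
  shows "N = haar"
proof -
  interpret N: finite_measure N by fact
  have space: "space N = torus" using sets_eq_imp_space_eq[OF sets] by simp
  \<comment> \<open>The trivial character fixes the total mass; a uniform error of
    \<open>e / 2\<close> then costs at most \<open>e / 2\<close> in each integral.\<close>
  have one: "measure N torus = 1" "measure haar (torus :: (complex ^ 'n) set) = 1"
    using char[of 0] haar.prob_space by (simp_all add: space)
  have meas: "f \<in> borel_measurable N \<longleftrightarrow> f \<in> borel_measurable haar" for f :: "complex ^ 'n \<Rightarrow> 'b::topological_space"
    using measurable_cong_sets[OF sets refl] by blast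
  have bdd: "integrable N f" "integrable haar f"
    if f: "continuous_on torus f" for f :: "complex ^ 'n \<Rightarrow> 'b::{banach,second_countable_topology}"
  proof -
    obtain B where "\<And>z. z \<in> torus \<Longrightarrow> norm (f z) \<le> B"
      using compact_imp_bounded[OF compact_continuous_image[OF f compact_torus]]
      by (auto simp: bounded_iff)
    then show "integrable N f" "integrable haar f"
      using borel_measurable_haar_continuous[OF f]
      by (auto intro!: N.integrable_const_bound[where B = B] haar.integrable_const_bound[where B = B] simp: space meas)
  qed
  have trig: "(\<integral>z. p z \<partial>N) = (\<integral>z. p z \<partial>haar)" if "trig_poly p" for p
    using that
  proof (induction rule: trig_poly.induct)
    case (add f g)
    then show ?case using bdd[OF trig_poly_continuous] by simp
  next
    case (cong f g)
    have "(\<integral>z. g z \<partial>N) = (\<integral>z. f z \<partial>N)" "(\<integral>z. g z \<partial>haar) = (\<integral>z. f z \<partial>haar)"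
      by (rule Bochner_Integration.integral_cong; use cong space in simp)+
    then show ?case using cong by simp
  qed (simp add: char)
  have cont: "(\<integral>z. g z \<partial>N) = (\<integral>z. g z \<partial>haar)" if g: "continuous_on torus g" for g :: "complex ^ 'n \<Rightarrow> real"
  proof -
    have "norm ((\<integral>z. of_real (g z) \<partial>N) - (\<integral>z. of_real (g z) \<partial>haar) :: complex) \<le> e" if "e > 0" for e
    proof -
      from \<open>e > 0\<close> have "e / 2 > 0" by simp
      then obtain p where p: "trig_poly p" and pe: "\<And>z. z \<in> torus \<Longrightarrow> norm (of_real (g z) - p z) < e / 2"
        using trig_poly_dense[OF g] by metis
      have gc: "continuous_on torus (\<lambda>z. complex_of_real (g z))" using g by (intro continuous_intros)
      note i = bdd[OF gc] bdd[OF trig_poly_continuous[OF p]]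
      have "norm (\<integral>z. of_real (g z) - p z \<partial>N) \<le> (\<integral>z. norm (of_real (g z) - p z) \<partial>N)"
        by (rule integral_norm_bound)
      also have "\<dots> \<le> (\<integral>z. e / 2 \<partial>N)"
        using pe i by (intro integral_mono) (auto simp: space intro!: less_imp_le)
      finally have 1: "norm (\<integral>z. of_real (g z) - p z \<partial>N) \<le> e / 2" by (simp add: space one)
      have "norm (\<integral>z. of_real (g z) - p z \<partial>haar) \<le> (\<integral>z. norm (of_real (g z) - p z) \<partial>haar)"
        by (rule integral_norm_bound)
      also have "\<dots> \<le> (\<integral>z. e / 2 \<partial>(haar :: (complex ^ 'n) measure))"
        using pe i by (intro integral_mono) (auto intro!: less_imp_le)
      finally have 2: "norm (\<integral>z. of_real (g z) - p z \<partial>haar) \<le> e / 2" by (simp add: one)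
      have "(\<integral>z. of_real (g z) \<partial>N) - (\<integral>z. of_real (g z) \<partial>haar) =
          (\<integral>z. of_real (g z) - p z \<partial>N) - (\<integral>z. of_real (g z) - p z \<partial>haar)"
        using i trig[OF p] by simp
      also have "norm \<dots> \<le> e" using 1 2 norm_triangle_ineq4 by (smt (verit) field_sum_of_halves)
      finally show ?thesis .
    qed
    then have "norm ((\<integral>z. of_real (g z) \<partial>N) - (\<integral>z. of_real (g z) \<partial>haar) :: complex) \<le> 0"
      by (metis field_le_epsilon add_0)
    then show ?thesis by simp
  qed
  have closed: "measure N (torus \<inter> C) = measure haar (torus \<inter> C)" if C: "closed C" for C
  proof -
    obtain g :: "nat \<Rightarrow> complex ^ 'n \<Rightarrow> real"
      where g: "\<And>n. continuous_on UNIV (g n)" "\<And>n z. 0 \<le> g n z" "\<And>n z. g n z \<le> 1"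
        "\<And>z. (\<lambda>n. g n z) \<longlonglongrightarrow> indicator C z"
      using closed_indicator_limit[OF C] by metis
    have gc: "continuous_on torus (g n)" for n using continuous_on_subset[OF g(1)] by simp
    have ind: "indicator C \<in> borel_measurable (haar :: (complex ^ 'n) measure)" (is "?i \<in> _")
    proof (rule borel_measurable_indicator')
      show "{z \<in> space haar. z \<in> C} \<in> sets haar"
        using C by (auto simp: sets_haar sets_restrict_space image_iff intro!: bexI[of _ C])
    qed
    have int: "integral\<^sup>L M (indicator C) = measure M (torus \<inter> C)" if "space M = torus" for M :: "(complex ^ 'n) measure"
      using that by (simp add: Int_commute)
    have "(\<lambda>n. \<integral>z. g n z \<partial>N) \<longlonglongrightarrow> (\<integral>z. indicator C z \<partial>N)"
      using g ind borel_measurable_haar_continuous[OF gc]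
      by (intro integral_dominated_convergence[where w = "\<lambda>_. 1"]) (auto simp: meas)
    moreover have "(\<lambda>n. \<integral>z. g n z \<partial>haar) \<longlonglongrightarrow> (\<integral>z. indicator C z \<partial>haar)"
      using g ind borel_measurable_haar_continuous[OF gc]
      by (intro integral_dominated_convergence[where w = "\<lambda>_. 1"]) auto
    ultimately have "(\<integral>z. indicator C z \<partial>N) = (\<integral>z. indicator C z \<partial>haar :: real)"
      using cont[OF gc] LIMSEQ_unique by simp
    then show ?thesis by (simp add: int space Int_commute)
  qed
  show ?thesis
  proof (rule measure_eqI_generator_eq[OF Int_stable_torus_closed, where \<Omega> = torus and A = "\<lambda>_. torus"])
    show "emeasure N X = emeasure haar X" if "X \<in> (\<inter>) torus ` Collect closed" for X
      using that closed by (auto simp: N.emeasure_eq_measure haar.emeasure_eq_measure)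
  qed (auto simp: sets sets_haar_closed N.emeasure_eq_measure image_iff intro!: exI[of _ UNIV])
qed

section \<open>Totality of the characters\<close>

lemma L2_eq_refl_iff [simp]: "L2_eq f f \<longleftrightarrow> sq_integrable f"
  by (auto simp: L2_eq_def)

lemma torus_L2_cases:
  obtains f where "sq_integrable f" "F = abs_torus_L2 f"
  using Quotient_rep_reflp[OF Quotient_torus_L2, of F] Quotient_abs_rep[OF Quotient_torus_L2, of F]
  by (metis L2_eq_refl_iff)

lemma abs_torus_L2_eqI:
  assumes "sq_integrable f" "sq_integrable g" "AE z in haar. f z = g z"
  shows "abs_torus_L2 f = abs_torus_L2 g"
  using Quotient_rel[OF Quotient_torus_L2] assms by (auto simp: L2_eq_def)

lemma abs_torus_L2_add:
  "sq_integrable f \<Longrightarrow> sq_integrable g \<Longrightarrow> abs_torus_L2 f + abs_torus_L2 g = abs_torus_L2 (\<lambda>z. f z + g z)"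
  by (simp add: plus_torus_L2.abs_eq)

lemma L2_scaleC_abs: "sq_integrable f \<Longrightarrow> L2_scaleC c (abs_torus_L2 f) = abs_torus_L2 (\<lambda>z. c * f z)"
  by (simp add: L2_scaleC.abs_eq)

lemma sq_integrable_diff:
  "sq_integrable f \<Longrightarrow> sq_integrable g \<Longrightarrow> sq_integrable (\<lambda>z. f z - g z)"
  using sq_integrable_add[of f "\<lambda>z. - g z"] sq_integrable_cmult[of g "-1"] by simp

lemma abs_torus_L2_diff:
  "sq_integrable f \<Longrightarrow> sq_integrable g \<Longrightarrow> abs_torus_L2 f - abs_torus_L2 g = abs_torus_L2 (\<lambda>z. f z - g z)"
  using sq_integrable_cmult[of g "-1"]
  by (simp add: minus_torus_L2_def uminus_torus_L2.abs_eq plus_torus_L2.abs_eq)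

lemma sq_integrable_bounded:
  assumes [measurable]: "f \<in> borel_measurable haar" and "\<And>z. z \<in> torus \<Longrightarrow> norm (f z) \<le> B"
  shows "sq_integrable f"
proof -
  have "integrable haar (\<lambda>z. (norm (f z))\<^sup>2)"
    using assms(2) by (intro haar.integrable_const_bound[where B = "B\<^sup>2"]) (auto intro!: power_mono)
  then show ?thesis by (simp add: sq_integrable_def)
qed

lemma sq_integrable_torus_char: "sq_integrable (torus_char m)"
  by (rule sq_integrable_bounded[where B = 1]) auto

lemma ebasis_eq: "ebasis m = abs_torus_L2 (torus_char m)"
  by (simp add: ebasis_def torus_char_def[abs_def])

lemma sq_integrable_sum:
  "(\<And>i. i \<in> I \<Longrightarrow> sq_integrable (f i)) \<Longrightarrow> sq_integrable (\<lambda>z. \<Sum>i\<in>I. f i z)"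
  by (induction I rule: infinite_finite_induct) (auto intro: sq_integrable_zero sq_integrable_add)

lemma abs_torus_L2_sum:
  assumes "\<And>i. i \<in> I \<Longrightarrow> sq_integrable (f i)"
  shows "(\<Sum>i\<in>I. abs_torus_L2 (f i)) = abs_torus_L2 (\<lambda>z. \<Sum>i\<in>I. f i z)"
  using assms
  by (induction I rule: infinite_finite_induct)
    (auto simp: zero_torus_L2.abs_eq abs_torus_L2_add sq_integrable_sum)

lemma norm_abs_torus_L2_diff:
  assumes "sq_integrable f" "sq_integrable g"
  shows "norm (abs_torus_L2 f - abs_torus_L2 g) = sqrt (\<integral>z. (norm (f z - g z))\<^sup>2 \<partial>haar)"
  using assms by (simp add: abs_torus_L2_diff norm_torus_L2_eq sq_integrable_diff)

text \<open>Dominated convergence for the squared distance. \<open>W\<close> dominates the error and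
  not the functions, so a constant serves for uniformly bounded errors.\<close>

lemma abs_torus_L2_tendsto:
  fixes g :: "complex ^ 'n::finite \<Rightarrow> complex"
  assumes f: "\<And>n. sq_integrable (f n)" and g: "sq_integrable g"
    and lim: "\<And>z. z \<in> torus \<Longrightarrow> (\<lambda>n. f n z) \<longlonglongrightarrow> g z"
    and W: "integrable haar W" "\<And>n z. z \<in> torus \<Longrightarrow> (norm (f n z - g z))\<^sup>2 \<le> W z"
  shows "(\<lambda>n. abs_torus_L2 (f n)) \<longlonglongrightarrow> abs_torus_L2 g"
proof -
  have [measurable]: "f n \<in> borel_measurable haar" "g \<in> borel_measurable haar" for n
    using f g by (auto simp: sq_integrable_def)
  have "(\<lambda>n. \<integral>z. (norm (f n z - g z))\<^sup>2 \<partial>haar) \<longlonglongrightarrow> (\<integral>z. 0 \<partial>(haar :: (complex ^ 'n) measure))"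
  proof (rule integral_dominated_convergence[where w = W])
    show "AE z in haar. (\<lambda>n. (norm (f n z - g z))\<^sup>2) \<longlonglongrightarrow> 0"
      using lim by (auto intro!: tendsto_null_power tendsto_norm_zero LIM_zero)
  qed (use W in auto)
  then have "(\<lambda>n. norm (abs_torus_L2 (f n) - abs_torus_L2 g)) \<longlonglongrightarrow> 0"
    using tendsto_real_sqrt by (fastforce simp: norm_abs_torus_L2_diff f g)
  then show ?thesis by (simp add: LIM_zero_iff tendsto_norm_zero_iff)
qed

text \<open>An induction principle: a closed real-linear condition on classes holds everywhere once
  it holds on multiples of characters. \<open>subspace\<close> is meant over the reals, which is why
  complex multiples are assumed. Membership climbs from trigonometric polynomials through continuous
  functions, indicators and simple functions to all of L^2.\<close>

proposition ebasis_total: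
  fixes M :: "'n::finite torus_L2 set"
  assumes M: "closed M" "subspace M" and e: "\<And>c m. L2_scaleC c (ebasis m) \<in> M"
  shows "M = UNIV"
proof -
  have lim: "abs_torus_L2 g \<in> M"
    if "\<And>n. sq_integrable (f n)" "sq_integrable g" "\<And>z. z \<in> torus \<Longrightarrow> (\<lambda>n. f n z) \<longlonglongrightarrow> g z"
      "integrable haar W" "\<And>n z. z \<in> torus \<Longrightarrow> (norm (f n z - g z))\<^sup>2 \<le> W z"
      "\<And>n. abs_torus_L2 (f n) \<in> M" for f g W
    using abs_torus_L2_tendsto[of f g W] closed_sequentially[OF M(1), of "\<lambda>n. abs_torus_L2 (f n)"] that
    by blast
  have cont_sq: "sq_integrable f" if f: "continuous_on torus f" for f :: "complex ^ 'n \<Rightarrow> complex"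
  proof -
    obtain B where "\<And>z. z \<in> torus \<Longrightarrow> norm (f z) \<le> B"
      using compact_imp_bounded[OF compact_continuous_image[OF f compact_torus]]
      by (auto simp: bounded_iff)
    then show ?thesis by (rule sq_integrable_bounded[OF borel_measurable_haar_continuous[OF f]])
  qed
  have trig: "abs_torus_L2 (\<lambda>z. c * p z) \<in> M" if "trig_poly p" for p and c :: complex
    using that
  proof (induction rule: trig_poly.induct)
    case (char d m)
    then show ?case
      using e[of "c * d" m] by (simp add: ebasis_eq L2_scaleC_abs sq_integrable_torus_char mult.assoc)
  next
    case (add f g)
    then have "sq_integrable (\<lambda>z. c * f z)" "sq_integrable (\<lambda>z. c * g z)"
      by (auto intro: sq_integrable_cmult[OF cont_sq[OF trig_poly_continuous]])
    then show ?case using subspace_add[OF M(2) add.IH] by (simp add: abs_torus_L2_add distrib_left)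
  next
    case (cong f g)
    then have "trig_poly g" by (metis trig_poly.cong)
    then have "abs_torus_L2 (\<lambda>z. c * f z) = abs_torus_L2 (\<lambda>z. c * g z)"
      using cong by (intro abs_torus_L2_eqI sq_integrable_cmult[OF cont_sq[OF trig_poly_continuous]]) auto
    then show ?case using cong by simp
  qed
  have cont: "abs_torus_L2 (\<lambda>z. c * of_real (g z)) \<in> M"
    if g: "continuous_on torus g" for g :: "complex ^ 'n \<Rightarrow> real" and c
  proof -
    have "\<exists>p. trig_poly p \<and> (\<forall>z\<in>torus. norm (of_real (g z) - p z) < inverse (real (Suc n)))" for n
      using trig_poly_dense[OF g, of "inverse (real (Suc n))"] by (metis inverse_positive_iff_positive of_nat_0_less_iff zero_less_Suc)
    then obtain p where p: "\<And>n. trig_poly (p n)"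
      and le: "\<And>n z. z \<in> torus \<Longrightarrow> norm (of_real (g z) - p n z) < inverse (real (Suc n))" by metis
    have le1: "norm (of_real (g z) - p n z) \<le> 1" if "z \<in> torus" for n z
      using le[OF that, of n] by (smt (verit, best) inverse_le_1_iff of_nat_0_le_iff of_nat_Suc)
    have tend: "(\<lambda>n. p n z) \<longlonglongrightarrow> of_real (g z)" if "z \<in> torus" for z
    proof -
      have "(\<lambda>n. p n z - of_real (g z)) \<longlonglongrightarrow> 0"
        using le[OF that] by (intro Lim_null_comparison[OF _ LIMSEQ_inverse_real_of_nat])
          (auto simp: norm_minus_commute intro!: always_eventually less_imp_le)
      then show ?thesis by (simp add: LIM_zero_iff)
    qed
    show ?thesis
    proof (rule lim[of "\<lambda>n z. c * p n z" _ "\<lambda>_. (norm c)\<^sup>2"])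
      show "sq_integrable (\<lambda>z. c * p n z)" "sq_integrable (\<lambda>z. c * complex_of_real (g z))" for n
        using p g by (auto intro!: sq_integrable_cmult[OF cont_sq] intro: trig_poly_continuous continuous_intros)
      show "(norm (c * p n z - c * complex_of_real (g z)))\<^sup>2 \<le> (norm c)\<^sup>2" if "z \<in> torus" for n z
        using le1[OF that, of n]
        by (auto simp flip: right_diff_distrib simp: norm_mult power_mult_distrib norm_minus_commute
            intro!: mult_left_le power_le_one)
    qed (auto intro!: tendsto_intros tend trig p)
  qed
  have ind: "sq_integrable (\<lambda>z. c * indicator A z)" if "A \<in> sets haar" for c and A :: "(complex ^ 'n) set"
    using that by (intro sq_integrable_bounded[where B = "norm c"]) (auto simp: indicator_def norm_mult)
  have sets: "\<forall>c. abs_torus_L2 (\<lambda>z. c * indicator A z) \<in> M" if A: "A \<in> sets haar" for A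
  proof -
    have "(\<inter>) torus ` Collect closed \<subseteq> Pow (torus :: (complex ^ 'n) set)" by auto
    from Int_stable_torus_closed this A[unfolded sets_haar_closed] show ?thesis
    proof (induction rule: sigma_sets_induct_disjoint)
      case (basic X)
      then obtain C where C: "closed C" "X = torus \<inter> C" by auto
      obtain g :: "nat \<Rightarrow> complex ^ 'n \<Rightarrow> real"
        where g: "\<And>n. continuous_on UNIV (g n)" "\<And>n z. 0 \<le> g n z" "\<And>n z. g n z \<le> 1"
          "\<And>z. (\<lambda>n. g n z) \<longlonglongrightarrow> indicator C z"
        using closed_indicator_limit[OF C(1)] by metis
      have gc: "continuous_on torus (g n)" for n using continuous_on_subset[OF g(1)] by simp
      have X: "X \<in> sets haar" unfolding sets_haar_closed using basic by auto
      show ?case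
      proof
        fix c
        show "abs_torus_L2 (\<lambda>z. c * indicator X z) \<in> M"
        proof (rule lim[of "\<lambda>n z. c * of_real (g n z)" _ "\<lambda>_. (norm c)\<^sup>2"])
          show "sq_integrable (\<lambda>z. c * of_real (g n z))" for n
            using gc by (intro sq_integrable_cmult cont_sq continuous_intros)
          have tends: "(\<lambda>n. c * of_real (g n z)) \<longlonglongrightarrow> c * of_real (indicator C z)" for z
            by (intro tendsto_intros g)
          show "(\<lambda>n. c * of_real (g n z)) \<longlonglongrightarrow> c * indicator X z" if "z \<in> torus" for z
          proof -
            have "complex_of_real (indicator C z) = indicator X z" using that by (simp add: C indicator_def)
            then show ?thesis using tends[of z] by simp
          qed
          show "(norm (c * of_real (g n z) - c * indicator X z))\<^sup>2 \<le> (norm c)\<^sup>2" if "z \<in> torus" for n z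
          proof -
            have "norm (complex_of_real (g n z) - of_real (indicator X z)) \<le> 1"
              using g(2,3)[of n z] unfolding of_real_diff[symmetric] norm_of_real by (auto simp: indicator_def)
            moreover have "complex_of_real (indicator X z) = indicator X z" by (simp add: indicator_def)
            ultimately have "norm (complex_of_real (g n z) - indicator X z) \<le> 1" by simp
            then show ?thesis
              by (auto simp flip: right_diff_distrib simp: norm_mult power_mult_distrib
                  intro!: mult_left_le power_le_one)
          qed
        qed (use ind X cont gc in auto)
      qed
    next
      case empty
      show ?case using subspace_0[OF M(2)] by (simp add: zero_torus_L2.abs_eq)
    next
      case (compl A)
      have A: "A \<in> sets haar" unfolding sets_haar_closed by fact
      show ?case
      proof
        fix c
        have "abs_torus_L2 (\<lambda>z. c * of_real 1) - abs_torus_L2 (\<lambda>z. c * indicator A z) \<in> M"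
          using compl cont[of "\<lambda>_. 1" c] by (intro subspace_diff[OF M(2)]) auto
        also have "abs_torus_L2 (\<lambda>z. c * of_real 1) - abs_torus_L2 (\<lambda>z. c * indicator A z) =
            abs_torus_L2 (\<lambda>z. c * of_real 1 - c * indicator A z)"
          by (intro abs_torus_L2_diff ind A cont_sq continuous_intros)
        also have "\<dots> = abs_torus_L2 (\<lambda>z. c * indicator (torus - A) z)"
          using A sets.compl_sets[OF A]
          by (intro abs_torus_L2_eqI sq_integrable_diff ind cont_sq continuous_intros) (auto simp: indicator_def)
        finally show "abs_torus_L2 (\<lambda>z. c * indicator (torus - A) z) \<in> M" .
      qed
    next
      case (union A)
      have A: "A i \<in> sets haar" for i unfolding sets_haar_closed using union by auto
      show ?case
      proof
        fix c
        show "abs_torus_L2 (\<lambda>z. c * indicator (\<Union>i. A i) z) \<in> M"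
        proof (rule lim[of "\<lambda>n z. \<Sum>i<n. c * indicator (A i) z" _ "\<lambda>_. (norm c)\<^sup>2"])
          have eq: "(\<Sum>i<n. c * indicator (A i) z) = c * indicator (\<Union>i<n. A i) z" for n z
            using disjoint_family_on_mono[OF _ union(1), of "{..<n}"]
            by (subst indicator_UN_disjoint) (auto simp: sum_distrib_left)
          show "(\<lambda>n. \<Sum>i<n. c * indicator (A i) z) \<longlonglongrightarrow> c * indicator (\<Union>i. A i) z" for z
            unfolding eq by (intro tendsto_intros LIMSEQ_indicator_UN)
          show "(norm ((\<Sum>i<n. c * indicator (A i) z) - c * indicator (\<Union>i. A i) z))\<^sup>2 \<le> (norm c)\<^sup>2" for n z
            unfolding eq by (auto simp: indicator_def)
          show "sq_integrable (\<lambda>z. \<Sum>i<n. c * indicator (A i) z)" for n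
            by (intro sq_integrable_sum ind A)
          show "sq_integrable (\<lambda>z. c * indicator (\<Union>i. A i) z)"
            using A by (intro ind) auto
          have "(\<Sum>i<n. abs_torus_L2 (\<lambda>z. c * indicator (A i) z)) \<in> M" for n
            using union by (intro subspace_sum[OF M(2)]) auto
          then show "abs_torus_L2 (\<lambda>z. \<Sum>i<n. c * indicator (A i) z) \<in> M" for n
            by (subst abs_torus_L2_sum[symmetric]) (auto intro: ind A)
        qed auto
      qed
    qed
  qed
  show ?thesis
  proof (intro set_eqI iffI UNIV_I)
    fix F :: "'n torus_L2"
    obtain f where f: "sq_integrable f" and F: "F = abs_torus_L2 f" by (rule torus_L2_cases)
    obtain s where "(\<forall>i. simple_function haar (s i)) \<and> (\<forall>z\<in>torus. (\<lambda>i. s i z) \<longlonglongrightarrow> f z) \<and>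
        (\<forall>i. \<forall>z\<in>torus. norm (s i z) \<le> 2 * norm (f z))"
      using borel_measurable_implies_sequence_metric[OF sq_integrable_measurable[OF f], of 0]
      unfolding space_haar dist_0_norm dist_norm diff_zero by blast
    then have s: "\<And>i. simple_function haar (s i)" "\<And>z. z \<in> torus \<Longrightarrow> (\<lambda>i. s i z) \<longlonglongrightarrow> f z"
      "\<And>i z. z \<in> torus \<Longrightarrow> norm (s i z) \<le> 2 * norm (f z)"
      by auto
    show "F \<in> M" unfolding F
    \<comment> \<open>The approximants satisfy \<open>norm (s i z) \<le> 2 * norm (f z)\<close>, so
      the error is at most three times \<open>norm (f z)\<close>; squaring gives 9.\<close>
    proof (rule lim[of s f "\<lambda>z. 9 * (norm (f z))\<^sup>2"])
      have A: "s i -` {y} \<inter> torus \<in> sets haar" for i y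
        using simple_functionD(2)[OF s(1)] by simp
      have si: "sq_integrable (\<lambda>z. y * indicator (s i -` {y} \<inter> torus) z)" for i y
        by (intro ind A)
      have fin: "finite (s i ` torus)" for i using simple_functionD(1)[OF s(1), of i] by simp
      have sum: "s i z = (\<Sum>y\<in>s i ` torus. y * indicator (s i -` {y} \<inter> torus) z)" if "z \<in> torus" for i z
        using that fin[of i] by (simp add: indicator_def if_distrib cong: if_cong)
      have sq: "sq_integrable (\<lambda>z. \<Sum>y\<in>s i ` torus. y * indicator (s i -` {y} \<inter> torus) z)" for i
        by (intro sq_integrable_sum si)
      show s_sq: "sq_integrable (s i)" for i
      proof -
        obtain B where B: "\<And>y. y \<in> s i ` torus \<Longrightarrow> norm y \<le> B"
          using finite_imp_bounded[OF fin[of i]] by (auto simp: bounded_iff)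
        then show ?thesis
          using borel_measurable_simple_function[OF s(1)] by (intro sq_integrable_bounded[where B = B]) auto
      qed
      have "(\<Sum>y\<in>s i ` torus. abs_torus_L2 (\<lambda>z. y * indicator (s i -` {y} \<inter> torus) z)) \<in> M" for i
        using sets A by (intro subspace_sum[OF M(2)]) auto
      also have "(\<Sum>y\<in>s i ` torus. abs_torus_L2 (\<lambda>z. y * indicator (s i -` {y} \<inter> torus) z)) = abs_torus_L2 (s i)" for i
        unfolding abs_torus_L2_sum[OF si]
        by (rule abs_torus_L2_eqI[OF sq s_sq], rule AE_I2) (simp flip: sum)
      finally show "abs_torus_L2 (s i) \<in> M" for i .
      show "(norm (s i z - f z))\<^sup>2 \<le> 9 * (norm (f z))\<^sup>2" if "z \<in> torus" for i z
      proof -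
        have "norm (s i z - f z) \<le> 3 * norm (f z)"
          using norm_triangle_ineq4[of "s i z" "f z"] s(3)[OF that, of i] by linarith
        then show ?thesis using power_mono[of _ _ 2] by (fastforce simp: power_mult_distrib)
      qed
    qed (use f s in \<open>auto simp: sq_integrable_def\<close>)
  qed
qed

section \<open>Bounded operators\<close>

lemma L2_cinner_abs:
  "sq_integrable f \<Longrightarrow> sq_integrable g \<Longrightarrow>
    L2_cinner (abs_torus_L2 f) (abs_torus_L2 g) = (\<integral>z. f z * cnj (g z) \<partial>haar)"
  by (simp add: L2_cinner.abs_eq)

lemma L2_cinner_add_left: "L2_cinner (F + G) H = L2_cinner F H + L2_cinner G H"
proof -
  obtain f g h where [simp]: "F = abs_torus_L2 f" "G = abs_torus_L2 g" "H = abs_torus_L2 h"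
    and sq: "sq_integrable f" "sq_integrable g" "sq_integrable h"
    using torus_L2_cases by metis
  then show ?thesis
    using sq_integrable_integrable_mult[of f h] sq_integrable_integrable_mult[of g h]
    by (simp add: abs_torus_L2_add sq_integrable_add L2_cinner_abs distrib_right)
qed

lemma L2_cinner_scaleC:
  "L2_cinner (L2_scaleC c F) G = c * L2_cinner F G"
  "L2_cinner F (L2_scaleC c G) = cnj c * L2_cinner F G"
proof -
  obtain f g where [simp]: "F = abs_torus_L2 f" "G = abs_torus_L2 g"
    and sq: "sq_integrable f" "sq_integrable g"
    using torus_L2_cases by metis
  show "L2_cinner (L2_scaleC c F) G = c * L2_cinner F G"
    using sq by (simp add: L2_scaleC_abs sq_integrable_cmult L2_cinner_abs mult.assoc)
  have "(\<integral>z. f z * (cnj c * cnj (g z)) \<partial>haar) = (\<integral>z. cnj c * (f z * cnj (g z)) \<partial>haar)"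
    by (simp add: mult_ac)
  then show "L2_cinner F (L2_scaleC c G) = cnj c * L2_cinner F G"
    using sq by (simp add: L2_scaleC_abs sq_integrable_cmult L2_cinner_abs)
qed

lemma L2_scaleC_of_real: "L2_scaleC (of_real r) F = r *\<^sub>R F"
  by (simp add: scaleR_torus_L2_def)

text \<open>The second argument is conjugate linear, so the real part of the pairing with
  \<open>\<i>\<close> times \<open>G\<close> is the imaginary part of the pairing with
  \<open>G\<close>. Continuity of the complex pairing thus comes from that of
  \<open>inner\<close>.\<close>

lemma L2_cinner_eq_inner: "L2_cinner F G = Complex (inner F G) (inner F (L2_scaleC \<i> G))"
  by (simp add: inner_torus_L2_def L2_cinner_scaleC complex_eq_iff)

lemma continuous_on_L2_cinner_left: "continuous_on UNIV (\<lambda>F. L2_cinner F G)"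
  unfolding L2_cinner_eq_inner Complex_eq by (intro continuous_intros)

lemma L2_cinner_zero_left [simp]: "L2_cinner 0 G = 0"
  using L2_cinner_add_left[of 0 0 G] by simp

text \<open>The vectors orthogonal to \<open>F - G\<close> form a closed subspace containing all
  multiples of characters, hence \<open>F - G\<close> itself.\<close>

lemma L2_eqI:
  assumes "\<And>m. L2_cinner F (ebasis m) = L2_cinner G (ebasis m)"
  shows "F = G"
proof -
  have D: "L2_cinner (F - G) (ebasis m) = 0" for m
    using L2_cinner_add_left[of "F - G" G "ebasis m"] assms[of m] by simp
  have "{H. inner (F - G) H = 0} = UNIV"
  proof (rule ebasis_total)
    show "closed {H. inner (F - G) H = 0}"
      by (intro closed_Collect_eq continuous_intros)
    show "subspace {H. inner (F - G) H = 0}"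
      by (auto simp: subspace_def inner_add_right)
    show "L2_scaleC c (ebasis m) \<in> {H. inner (F - G) H = 0}" for c m
      using D by (simp add: inner_torus_L2_def L2_cinner_scaleC)
  qed
  then have "inner (F - G) (F - G) = 0" by blast
  then show ?thesis by simp
qed

lemma bounded_clinear_L2_scaleC: "bounded_clinear_L2 T \<Longrightarrow> T (L2_scaleC c F) = L2_scaleC c (T F)"
  by (simp add: bounded_clinear_L2_def)

lemma bounded_clinear_L2_compose:
  "bounded_clinear_L2 S \<Longrightarrow> bounded_clinear_L2 T \<Longrightarrow> bounded_clinear_L2 (\<lambda>F. S (T F))"
  by (simp add: bounded_clinear_L2_def bounded_linear_compose)

lemma bounded_clinear_L2_eqI:
  assumes S: "bounded_clinear_L2 S" and T: "bounded_clinear_L2 T" and eq: "\<And>m. S (ebasis m) = T (ebasis m)"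
  shows "S = T"
proof -
  interpret S: bounded_linear S using S by (simp add: bounded_clinear_L2_def)
  interpret T: bounded_linear T using T by (simp add: bounded_clinear_L2_def)
  have "{F. S F = T F} = UNIV"
  proof (rule ebasis_total)
    show "closed {F. S F = T F}"
      by (intro closed_Collect_eq linear_continuous_on S.bounded_linear_axioms T.bounded_linear_axioms)
    show "subspace {F. S F = T F}"
      by (auto simp: subspace_def S.zero T.zero S.add T.add S.scaleR T.scaleR)
  qed (simp add: bounded_clinear_L2_scaleC S T eq)
  then show ?thesis by auto
qed

lemma norm_abs_torus_L2_power2:
  "sq_integrable f \<Longrightarrow> (norm (abs_torus_L2 f))\<^sup>2 = (\<integral>z. (norm (f z))\<^sup>2 \<partial>haar)"
  by (simp add: norm_torus_L2_eq)

text \<open>Template for multiplication, fibre averaging and composition with the power map: each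
  acts on functions by a rule \<open>A\<close> that is linear at every point, so only square
  integrability and the norm bound need integration.\<close>

lemma bounded_clinear_L2I:
  assumes T: "\<And>f. sq_integrable f \<Longrightarrow> T (abs_torus_L2 f) = abs_torus_L2 (A f)"
    and sq: "\<And>f. sq_integrable f \<Longrightarrow> sq_integrable (A f)"
    and add: "\<And>f g z. A (\<lambda>z. f z + g z) z = A f z + A g z"
    and scale: "\<And>c f z. A (\<lambda>z. c * f z) z = c * A f z"
    and bound: "\<And>f. sq_integrable f \<Longrightarrow> (\<integral>z. (norm (A f z))\<^sup>2 \<partial>haar) \<le> C\<^sup>2 * (\<integral>z. (norm (f z))\<^sup>2 \<partial>haar)"
  shows "bounded_clinear_L2 T"
proof -
  have A: "A (\<lambda>z. f z + g z) = (\<lambda>z. A f z + A g z)" "A (\<lambda>z. c * f z) = (\<lambda>z. c * A f z)" for c f g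
    using add scale by blast+
  have s: "T (L2_scaleC c F) = L2_scaleC c (T F)" for c F
    by (rule torus_L2_cases[of F]) (simp add: L2_scaleC_abs T sq_integrable_cmult sq A)
  have "bounded_linear T"
  \<comment> \<open>Only the square of \<open>C\<close> enters \<open>bound\<close>, so no sign of
    \<open>C\<close> is assumed.\<close>
  proof (rule bounded_linear_intro[where K = "\<bar>C\<bar>"])
    fix F G :: "'a torus_L2" and r :: real
    obtain f where f: "sq_integrable f" "F = abs_torus_L2 f" by (rule torus_L2_cases)
    obtain g where g: "sq_integrable g" "G = abs_torus_L2 g" by (rule torus_L2_cases)
    show "T (F + G) = T F + T G"
      by (simp add: f g abs_torus_L2_add T sq sq_integrable_add A)
    show "T (r *\<^sub>R F) = r *\<^sub>R T F"
      using s[of "of_real r" F] by (simp add: L2_scaleC_of_real)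
    have "(norm (T F))\<^sup>2 \<le> (norm F * \<bar>C\<bar>)\<^sup>2"
      using bound[OF f(1)] by (simp add: f T sq norm_abs_torus_L2_power2 power_mult_distrib mult.commute)
    then show "norm (T F) \<le> norm F * \<bar>C\<bar>" by (rule power2_le_imp_le) simp
  qed
  with s show ?thesis by (simp add: bounded_clinear_L2_def)
qed

lemma rep_abs_torus_L2:
  assumes "sq_integrable f"
  shows "sq_integrable (rep_torus_L2 (abs_torus_L2 f))" "AE z in haar. rep_torus_L2 (abs_torus_L2 f) z = f z"
proof -
  have "L2_eq (rep_torus_L2 (abs_torus_L2 f)) f"
    using assms rep_abs_rsp_left[OF Quotient3_torus_L2, of f f] by simp
  then show "sq_integrable (rep_torus_L2 (abs_torus_L2 f))" "AE z in haar. rep_torus_L2 (abs_torus_L2 f) z = f z"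
    by (simp_all add: L2_eq_def)
qed

section \<open>Multiplication by bounded functions and by characters\<close>

lemma Linf_sq_integrable_mult: "\<phi> \<in> Linf \<Longrightarrow> sq_integrable f \<Longrightarrow> sq_integrable (\<lambda>z. \<phi> z * f z)"
  unfolding Linf_def using sq_integrable_bounded_mult by blast

lemma mult_op_abs:
  "\<phi> \<in> Linf \<Longrightarrow> sq_integrable f \<Longrightarrow> mult_op \<phi> (abs_torus_L2 f) = abs_torus_L2 (\<lambda>z. \<phi> z * f z)"
  by (simp add: mult_op.abs_eq)

lemma bounded_clinear_L2_mult_op:
  fixes \<phi> :: "complex ^ 'n::finite \<Rightarrow> complex"
  assumes \<phi>: "\<phi> \<in> Linf"
  shows "bounded_clinear_L2 (mult_op \<phi>)"
proof -
  obtain C where C: "AE z in haar. norm (\<phi> z) \<le> C" using \<phi> by (auto simp: Linf_def)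
  show ?thesis
  proof (rule bounded_clinear_L2I[where A = "\<lambda>f z. \<phi> z * f z" and C = C])
    fix f :: "complex ^ 'n \<Rightarrow> complex" assume f: "sq_integrable f"
    have i: "integrable haar (\<lambda>z. (norm (\<phi> z * f z))\<^sup>2)" "integrable haar (\<lambda>z. (norm (f z))\<^sup>2)"
      using f Linf_sq_integrable_mult[OF \<phi> f] by (auto simp: sq_integrable_def)
    have "(\<integral>z. (norm (\<phi> z * f z))\<^sup>2 \<partial>haar) \<le> (\<integral>z. C\<^sup>2 * (norm (f z))\<^sup>2 \<partial>haar)"
    proof (rule integral_mono_AE)
      show "AE z in haar. (norm (\<phi> z * f z))\<^sup>2 \<le> C\<^sup>2 * (norm (f z))\<^sup>2"
        using C by eventually_elim
          (auto simp: norm_mult power_mult_distrib intro!: mult_right_mono power_mono)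
    qed (use i in auto)
    then show "(\<integral>z. (norm (\<phi> z * f z))\<^sup>2 \<partial>haar) \<le> C\<^sup>2 * (\<integral>z. (norm (f z))\<^sup>2 \<partial>haar)" by simp
  qed (auto simp: mult_op_abs Linf_sq_integrable_mult \<phi> distrib_left mult.left_commute)
qed

lemma torus_char_Linf: "torus_char m \<in> Linf"
  by (auto simp: Linf_def intro!: exI[of _ 1])

lemma mult_op_char_ebasis: "mult_op (torus_char m) (ebasis l) = ebasis (m + l)"
  unfolding ebasis_eq
  using Linf_sq_integrable_mult[OF torus_char_Linf sq_integrable_torus_char]
  by (subst mult_op_abs)
    (auto intro!: abs_torus_L2_eqI simp: torus_char_Linf sq_integrable_torus_char torus_char_add)

text \<open>Characters have modulus 1 on the torus, so multiplication by one is unitary.\<close>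

lemma L2_cinner_mult_op_char:
  "L2_cinner (mult_op (torus_char m) F) (mult_op (torus_char m) G) = L2_cinner F G"
proof -
  obtain f g where [simp]: "F = abs_torus_L2 f" "G = abs_torus_L2 g"
    and sq: "sq_integrable f" "sq_integrable g"
    using torus_L2_cases by metis
  have "torus_char m z * f z * (cnj (torus_char m z) * cnj (g z)) = f z * cnj (g z)" if "z \<in> torus" for z
  proof -
    have "torus_char m z * cnj (torus_char m z) = 1"
      using that by (simp add: complex_norm_square[symmetric])
    then show ?thesis by (metis (no_types, lifting) mult.assoc mult.left_commute mult_1)
  qed
  then have "(\<integral>z. torus_char m z * f z * (cnj (torus_char m z) * cnj (g z)) \<partial>haar) = (\<integral>z. f z * cnj (g z) \<partial>haar)"
    by (intro Bochner_Integration.integral_cong) auto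
  then show ?thesis
    using sq by (simp add: mult_op_abs torus_char_Linf Linf_sq_integrable_mult L2_cinner_abs)
qed

section \<open>Averaging over inverse roots\<close>

lemma measurable_haarI:
  fixes F :: "complex ^ 'n::finite \<Rightarrow> complex ^ 'n"
  assumes "\<And>z. z \<in> torus \<Longrightarrow> F z \<in> torus" "\<And>j. (\<lambda>z. F z $ j) \<in> borel_measurable haar"
  shows "F \<in> haar \<rightarrow>\<^sub>M haar"
proof -
  have [measurable]: "(\<lambda>z. F z $ j) \<in> borel_measurable haar" for j by fact
  have "F \<in> borel_measurable haar"
  proof (rule iffD2[OF borel_measurable_euclidean_space], rule ballI)
    fix b :: "complex ^ 'n" assume "b \<in> Basis"
    then obtain j c where "b = axis j c" unfolding Basis_vec_def by blast
    then have "(\<lambda>z. F z \<bullet> b) = (\<lambda>z. F z $ j \<bullet> c)" by (simp add: inner_axis)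
    then show "(\<lambda>z. F z \<bullet> b) \<in> borel_measurable haar" by simp
  qed
  moreover have "F \<in> space haar \<rightarrow> torus" using assms(1) by simp
  ultimately have "F \<in> haar \<rightarrow>\<^sub>M restrict_space borel torus"
    by (intro measurable_restrict_space2)
  then show ?thesis by (simp only: measurable_cong_sets[OF refl sets_haar])
qed

lemma measurable_haar_nth [measurable]: "(\<lambda>z. z $ j) \<in> borel_measurable haar"
  by (intro borel_measurable_haar_continuous continuous_intros)

text \<open>The map \<open>p\<close> of the overview. The negative exponent matches the sign in the
  values of V: pulling back the character \<open>m\<close> gives the character
  \<open>- k *s m\<close>.\<close>

definition inv_power :: "int \<Rightarrow> complex ^ 'n::finite \<Rightarrow> complex ^ 'n" where
  "inv_power k z = (\<chi> j. z $ j powi (- k))"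

lemma inv_power_torus [simp]: "z \<in> torus \<Longrightarrow> inv_power k z \<in> torus"
  by (simp add: torus_def inv_power_def norm_power_int)

lemma measurable_inv_power [measurable]: "inv_power k \<in> haar \<rightarrow>\<^sub>M haar"
proof (rule measurable_haarI)
  show "(\<lambda>z::complex^'n. inv_power k z $ j) \<in> borel_measurable haar" for j
    unfolding inv_power_def
    by (simp, intro borel_measurable_haar_continuous continuous_intros) (auto simp: torus_nth_nonzero)
qed simp

lemma torus_char_inv_power: "torus_char m (inv_power k z) = torus_char (- k *s m) z"
  by (simp add: torus_char_def inv_power_def flip: power_int_mult)

text \<open>Pulling back sends the index \<open>m\<close> to \<open>- k *s m\<close>, which is zero
  exactly when \<open>m\<close> is, so the Fourier coefficients of both measures agree.\<close>

lemma distr_inv_power: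
  assumes "k \<noteq> 0"
  shows "distr haar haar (inv_power k) = (haar :: (complex ^ 'n::finite) measure)"
proof (rule haar_eqI)
  show "finite_measure (distr haar haar (inv_power k) :: (complex ^ 'n) measure)"
    by (rule haar.finite_measure_distr) simp
  fix m :: "int ^ 'n"
  have "- k *s m = 0 \<longleftrightarrow> m = 0" using assms by (auto simp: vec_eq_iff)
  then show "(\<integral>z. torus_char m z \<partial>distr haar haar (inv_power k)) = (\<integral>z. torus_char m z \<partial>haar)"
    by (simp add: integral_distr torus_char_inv_power integral_torus_char)
qed simp

text \<open>The \<open>CARD('n)\<close>-tuples of \<open>k\<close>-th roots of unity are indexed by their exponents; together
  with the principal branch of \<open>z\<^sub>j powr (-1 / k)\<close> they give all preimages of \<open>z\<close> under \<open>inv_power k\<close>.\<close>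

definition root_index :: "int \<Rightarrow> ('n::finite \<Rightarrow> nat) set" where
  "root_index k = PiE UNIV (\<lambda>_. {..<nat k})"

definition inv_root :: "int \<Rightarrow> ('n::finite \<Rightarrow> nat) \<Rightarrow> complex ^ 'n \<Rightarrow> complex ^ 'n" where
  "inv_root k r z = (\<chi> j. cis (2 * pi / k) ^ r j * exp (- Ln (z $ j) / k))"

text \<open>The values are left general because the average is applied both to complex functions and
  to their real squared norms.\<close>

definition root_avg :: "int \<Rightarrow> (complex ^ 'n::finite \<Rightarrow> 'b::real_vector) \<Rightarrow> complex ^ 'n \<Rightarrow> 'b" where
  "root_avg k f z = (1 / card (root_index k :: ('n \<Rightarrow> nat) set)) *\<^sub>R (\<Sum>r\<in>root_index k. f (inv_root k r z))"

lemma finite_root_index [simp]: "finite (root_index k :: ('n::finite \<Rightarrow> nat) set)"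
  by (simp add: root_index_def finite_PiE)

lemma card_root_index: "card (root_index k :: ('n::finite \<Rightarrow> nat) set) = nat k ^ CARD('n)"
  by (simp add: root_index_def card_PiE)

lemma root_index_nonempty: "k > 0 \<Longrightarrow> root_index k \<noteq> {}"
  by (auto simp: root_index_def PiE_eq_empty_iff lessThan_empty_iff bot_nat_def)

lemma norm_exp_Ln_unit: "norm w = 1 \<Longrightarrow> norm (exp (- Ln w / of_int k)) = 1"
proof -
  assume "norm w = 1"
  then have "Re (Ln w) = 0" using Re_Ln[of w] by (cases "w = 0") auto
  then show ?thesis by (simp add: norm_exp_eq_Re Re_divide_of_real[of _ "real_of_int k", simplified])
qed

lemma inv_root_torus [simp]: "z \<in> torus \<Longrightarrow> inv_root k r z \<in> torus"
  by (simp add: torus_def inv_root_def norm_mult norm_power norm_exp_Ln_unit[simplified])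

text \<open>\<open>Ln\<close> jumps across its branch cut, but it is Borel, and measurability is
  enough.\<close>

lemma measurable_inv_root [measurable]: "inv_root k r \<in> haar \<rightarrow>\<^sub>M haar"
  by (rule measurable_haarI) (simp, simp add: inv_root_def)

lemma inv_power_inv_root:
  assumes "k > 0" "z \<in> torus"
  shows "inv_power k (inv_root k r z) = z"
proof -
  have "(cis (2 * pi / k) ^ n * exp (- Ln (z $ j) / k)) powi (- k) = z $ j" for n j
  proof -
    have "(cis (2 * pi / k) ^ n) powi (- k) = cis (real n * (2 * pi / k)) powi (- k)"
      by (simp only: Complex.DeMoivre)
    also have "\<dots> = cis (2 * pi * of_int (- int n))"
      using assms(1) unfolding cis_power_int by (intro arg_cong[where f = cis]) (simp add: field_simps)
    also have "\<dots> = 1" by (rule cis_multiple_2pi) simp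
    finally have 1: "(cis (2 * pi / k) ^ n) powi (- k) = 1" .
    have "exp (- Ln (z $ j) / k) powi (- k) = exp (of_int (- k) * (- Ln (z $ j) / k))"
      by (rule exp_power_int)
    also have "of_int (- k) * (- Ln (z $ j) / k) = Ln (z $ j)" using assms(1) by simp
    finally have 2: "exp (- Ln (z $ j) / k) powi (- k) = z $ j"
      using torus_nth_nonzero[OF assms(2)] by simp
    show ?thesis using 1 2 by (simp only: power_int_mult_distrib mult_1)
  qed
  then show ?thesis by (simp add: inv_power_def inv_root_def vec_eq_iff)
qed

text \<open>With \<open>w\<close> the a-th power of the primitive root this is a geometric sum;
  \<open>w\<close> has k-th power 1, and it equals 1 exactly when \<open>k\<close> divides
  \<open>a\<close>.\<close>

lemma sum_powers_root_of_unity: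
  assumes "k > 0"
  shows "(\<Sum>s<nat k. (cis (2 * pi / k) ^ s) powi a) = (if k dvd a then of_int k else 0)"
proof -
  define w where "w = cis (2 * pi * a / k)"
  have "(cis (2 * pi / k) ^ s) powi a = w ^ s" for s
    unfolding w_def Complex.DeMoivre cis_power_int by (intro arg_cong[where f = cis]) simp
  then have eq: "(\<Sum>s<nat k. (cis (2 * pi / k) ^ s) powi a) = (\<Sum>s<nat k. w ^ s)" by simp
  have w1: "w = 1 \<longleftrightarrow> k dvd a"
  proof
    assume "w = 1"
    then obtain n where "2 * pi * a / k = of_int n * (2 * pi)" unfolding w_def cis_eq_1_iff by blast
    then have "real_of_int a = of_int (k * n)" using assms by (simp add: field_simps)
    then show "k dvd a" unfolding of_int_eq_iff by simp
  next
    assume "k dvd a"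
    then obtain l where "a = k * l" by blast
    then have "2 * pi * a / k = 2 * pi * of_int l" using assms by simp
    then show "w = 1" unfolding w_def using cis_multiple_2pi[of "of_int l"] by simp
  qed
  have "w ^ nat k = cis (2 * pi * of_int a)"
    unfolding w_def Complex.DeMoivre using assms by (intro arg_cong[where f = cis]) simp
  then have "w ^ nat k = 1" using cis_multiple_2pi[of "of_int a"] by simp
  then have "(\<Sum>s<nat k. w ^ s) = 0" if "w \<noteq> 1"
    using that by (simp add: geometric_sum)
  then show ?thesis using w1 eq assms by (auto simp: of_nat_nat)
qed

text \<open>The indices range over a full product, so the sum over fibre points factors into one sum
  over roots of unity per coordinate. Each is \<open>k\<close> or 0, and the result reproduces the
  values prescribed for V.\<close>

lemma root_avg_torus_char:
  fixes z :: "complex ^ 'n::finite"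
  assumes k: "k > 0" and z: "z \<in> torus"
  shows "root_avg k (torus_char m) z = (if \<forall>j. k dvd m $ j then torus_char (\<chi> j. - (m $ j div k)) z else 0)"
proof -
  have "(\<Sum>r\<in>root_index k. torus_char m (inv_root k r z)) =
      (\<Sum>r\<in>root_index k. \<Prod>j\<in>UNIV. (cis (2 * pi / k) ^ r j) powi m $ j * exp (- Ln (z $ j) / k) powi m $ j)"
    by (simp add: torus_char_def inv_root_def power_int_mult_distrib)
  also have "\<dots> = (\<Prod>j\<in>UNIV. \<Sum>s<nat k. (cis (2 * pi / k) ^ s) powi m $ j * exp (- Ln (z $ j) / k) powi m $ j)"
    unfolding root_index_def by (rule prod_sum_PiE[symmetric]) auto
  also have "\<dots> = (\<Prod>j\<in>UNIV. (if k dvd m $ j then of_int k * z $ j powi (- (m $ j div k)) else 0))"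
  proof (rule prod.cong[OF refl])
    fix j
    \<comment> \<open>The choice of logarithm disappears here: the exponent is a multiple of
      \<open>k\<close>, and \<open>exp (Ln (z $ j))\<close> is \<open>z $ j\<close>.\<close>
    have "exp (- Ln (z $ j) / k) powi m $ j = z $ j powi (- (m $ j div k))" if d: "k dvd m $ j"
    proof -
      from d obtain l where l: "m $ j = k * l" by blast
      have "exp (- Ln (z $ j) / k) powi m $ j = exp (of_int (- l) * Ln (z $ j))"
        unfolding exp_power_int l using k by simp
      also have "\<dots> = exp (Ln (z $ j)) powi (- l)" by (simp only: exp_power_int)
      finally show ?thesis using torus_nth_nonzero[OF z] k by (simp add: l)
    qed
    then show "(\<Sum>s<nat k. (cis (2 * pi / k) ^ s) powi m $ j * exp (- Ln (z $ j) / k) powi m $ j) =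
        (if k dvd m $ j then of_int k * z $ j powi (- (m $ j div k)) else 0)"
      unfolding sum_distrib_right[symmetric] sum_powers_root_of_unity[OF k] by simp
  qed
  also have "\<dots> = (if \<forall>j. k dvd m $ j then of_int k ^ CARD('n) * torus_char (\<chi> j. - (m $ j div k)) z else 0)"
    by (auto simp: torus_char_def prod.distrib intro!: prod_zero)
  finally show ?thesis
    using k by (simp add: root_avg_def card_root_index scaleR_conv_of_real of_nat_nat)
qed

text \<open>All points averaged for \<open>z\<close> are mapped to \<open>z\<close> by
  \<open>inv_power k\<close>, so the first factor is constantly \<open>g z\<close>.\<close>

lemma root_avg_mult:
  fixes f :: "complex ^ 'n::finite \<Rightarrow> complex"
  assumes "k > 0" "z \<in> torus"
  shows "root_avg k (\<lambda>z. g (inv_power k z) * f z) z = g z * root_avg k f z"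
  using assms by (simp add: root_avg_def inv_power_inv_root sum_distrib_left)

text \<open>Both measures have the same integrals of characters, by \<open>root_avg_torus_char\<close>.\<close>

lemma haar_eq_distr_inv_root:
  fixes k :: int
  assumes k: "k > 0"
  defines "P \<equiv> measure_pmf (pmf_of_set (root_index k :: ('n::finite \<Rightarrow> nat) set))"
  shows "(\<lambda>(r, z). inv_root k r z) \<in> P \<Otimes>\<^sub>M haar \<rightarrow>\<^sub>M (haar :: (complex ^ 'n) measure)"
    and "distr (P \<Otimes>\<^sub>M haar) haar (\<lambda>(r, z). inv_root k r z) = (haar :: (complex ^ 'n) measure)"
proof -
  let ?h = "haar :: (complex ^ 'n) measure"
  have "(\<lambda>(r, z). inv_root k r z) \<in> count_space (UNIV :: ('n \<Rightarrow> nat) set) \<Otimes>\<^sub>M ?h \<rightarrow>\<^sub>M ?h"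
    by (rule measurable_pair_measure_countable1) auto
  moreover have "sets (P \<Otimes>\<^sub>M ?h) = sets (count_space UNIV \<Otimes>\<^sub>M ?h)"
    unfolding P_def by (rule sets_pair_measure_cong) auto
  ultimately show m [measurable]: "(\<lambda>(r, z). inv_root k r z) \<in> P \<Otimes>\<^sub>M ?h \<rightarrow>\<^sub>M ?h"
    using measurable_cong_sets by blast
  interpret P: prob_space P unfolding P_def by (rule prob_space_measure_pmf)
  interpret Q: pair_prob_space P ?h ..
  show "distr (P \<Otimes>\<^sub>M haar) haar (\<lambda>(r, z). inv_root k r z) = ?h"
  proof (rule haar_eqI)
    show "finite_measure (distr (P \<Otimes>\<^sub>M ?h) ?h (\<lambda>(r, z). inv_root k r z))"
      by (rule Q.finite_measure_distr) (rule m)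
    fix m :: "int ^ 'n"
    have int: "integrable haar (\<lambda>z. torus_char m (inv_root k r z))" for r
      by (rule haar.integrable_const_bound[where B = 1]) auto
    have "(\<integral>z. torus_char m z \<partial>distr (P \<Otimes>\<^sub>M ?h) ?h (\<lambda>(r, z). inv_root k r z)) =
        (\<integral>x. torus_char m (case x of (r, z) \<Rightarrow> inv_root k r z) \<partial>(P \<Otimes>\<^sub>M ?h))"
      by (rule integral_distr) measurable
    also have "\<dots> = (\<integral>r. \<integral>z. torus_char m (inv_root k r z) \<partial>haar \<partial>P)"
    proof (subst Q.integral_fst'[symmetric])
      have "(\<lambda>x. torus_char m (case x of (r, z) \<Rightarrow> inv_root k r z)) \<in> borel_measurable (P \<Otimes>\<^sub>M ?h)"
        by measurable
      then show "integrable (P \<Otimes>\<^sub>M ?h) (\<lambda>x. torus_char m (case x of (r, z) \<Rightarrow> inv_root k r z))"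
        by (intro Q.integrable_const_bound[where B = 1]) (auto simp: space_pair_measure)
    qed simp
    also have "\<dots> = (1 / card (root_index k :: ('n \<Rightarrow> nat) set)) *\<^sub>R (\<Sum>r\<in>root_index k. \<integral>z. torus_char m (inv_root k r z) \<partial>?h)"
      unfolding P_def using root_index_nonempty[OF k, where ?'a = 'n]
      by (subst integral_measure_pmf[of "root_index k"]) (auto simp: pmf_of_set scaleR_sum_right intro!: sum.cong)
    also have "\<dots> = (\<integral>z. root_avg k (torus_char m) z \<partial>haar)"
      unfolding root_avg_def using int by simp
    also have "\<dots> = (\<integral>z. (if \<forall>j. k dvd m $ j then torus_char (\<chi> j. - (m $ j div k)) z else 0) \<partial>?h)"
      by (rule Bochner_Integration.integral_cong[OF refl]) (simp add: root_avg_torus_char k)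
    also have "\<dots> = (\<integral>z. torus_char m z \<partial>haar)"
    proof -
      \<comment> \<open>If \<open>k\<close> divides \<open>m\<close>, the new index vanishes only
        for \<open>m = 0\<close>; otherwise \<open>m\<close> is nonzero and both integrals are
        0.\<close>
      have "(\<chi> j. - (m $ j div k)) = 0 \<longleftrightarrow> m = 0" if "\<forall>j. k dvd m $ j"
        using that k by (auto simp: vec_eq_iff dvd_div_eq_0_iff)
      moreover have "\<forall>j. k dvd m $ j" if "m = 0" using that by simp
      ultimately show ?thesis
        by (cases "\<forall>j. k dvd m $ j"; cases "m = 0") (simp_all only: integral_torus_char if_True if_False simp_thms, simp_all)
    qed
    finally show "(\<integral>z. torus_char m z \<partial>distr (P \<Otimes>\<^sub>M ?h) ?h (\<lambda>(r, z). inv_root k r z)) = (\<integral>z. torus_char m z \<partial>?h)" .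
  qed simp
qed

text \<open>For \<open>k\<close> at least 2 a single inverse root does not preserve Haar measure,
  but the uniform mixture of all of them does. Each has positive weight in the mixture, so null sets
  still pull back to null sets.\<close>

lemma AE_inv_root:
  assumes k: "k > 0" and ae: "AE z in haar. Q z" and r: "r \<in> root_index k"
  shows "AE z in haar. Q (inv_root k r z)"
proof -
  let ?P = "measure_pmf (pmf_of_set (root_index k :: ('a \<Rightarrow> nat) set))"
  interpret P: prob_space ?P by (rule prob_space_measure_pmf)
  interpret Q: pair_prob_space ?P "haar :: (complex ^ 'a) measure" ..
  have "AE z in distr (?P \<Otimes>\<^sub>M haar) haar (\<lambda>(r, z). inv_root k r z). Q z"
    unfolding haar_eq_distr_inv_root(2)[OF k] by (rule ae)
  from Q.AE_pair[OF AE_distrD[OF haar_eq_distr_inv_root(1)[OF k] this]] show ?thesis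
    using r root_index_nonempty[OF k, where ?'a = 'a] by (auto simp: AE_measure_pmf_iff set_pmf_of_set)
qed

text \<open>A Haar point may be replaced by a uniformly random inverse root of a Haar point; Fubini
  with a finite first factor gives both claims.\<close>

lemma root_avg_integral:
  fixes u :: "complex ^ 'n::finite \<Rightarrow> 'b::{banach, second_countable_topology}"
  assumes k: "k > 0" and u: "integrable haar u"
  shows "\<And>r. r \<in> root_index k \<Longrightarrow> integrable haar (\<lambda>z. u (inv_root k r z))"
    and "(\<integral>z. root_avg k u z \<partial>haar) = (\<integral>z. u z \<partial>haar)"
proof -
  let ?P = "measure_pmf (pmf_of_set (root_index k :: ('n \<Rightarrow> nat) set))"
  let ?T = "\<lambda>(r, z). inv_root k r z :: complex ^ 'n"
  interpret P: prob_space ?P by (rule prob_space_measure_pmf)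
  interpret Q: pair_prob_space ?P "haar :: (complex ^ 'n) measure" ..
  note T = haar_eq_distr_inv_root[OF k, where ?'n = 'n]
  note ne = root_index_nonempty[OF k, where ?'a = 'n]
  have "integrable (distr (?P \<Otimes>\<^sub>M haar) haar ?T) u" unfolding T(2) by (rule u)
  note int = integrable_distr[OF T(1) this]
  show i: "integrable haar (\<lambda>z. u (inv_root k r z))" if "r \<in> root_index k" for r
    using Q.AE_integrable_fst'[OF int] that ne by (auto simp: AE_measure_pmf_iff set_pmf_of_set)
  have "(\<integral>z. u z \<partial>haar) = (\<integral>z. u z \<partial>distr (?P \<Otimes>\<^sub>M haar) haar ?T)" by (simp only: T(2))
  also have "\<dots> = (\<integral>x. u (?T x) \<partial>(?P \<Otimes>\<^sub>M haar))"
    by (rule integral_distr[OF T(1) borel_measurable_integrable[OF u]])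
  also have "\<dots> = (\<integral>r. \<integral>z. u (inv_root k r z) \<partial>haar \<partial>?P)"
    using Q.integral_fst'[OF int] by simp
  also have "\<dots> = (1 / card (root_index k :: ('n \<Rightarrow> nat) set)) *\<^sub>R (\<Sum>r\<in>root_index k. \<integral>z. u (inv_root k r z) \<partial>haar)"
    using ne by (subst integral_measure_pmf[of "root_index k"]) (auto simp: pmf_of_set scaleR_sum_right intro!: sum.cong)
  also have "\<dots> = (\<integral>z. root_avg k u z \<partial>haar)"
    unfolding root_avg_def using i by simp
  finally show "(\<integral>z. root_avg k u z \<partial>haar) = (\<integral>z. u z \<partial>haar)" ..
qed

text \<open>Jensen's inequality for the uniform distribution on the fibre. For
  \<open>k \<le> 0\<close> the index set is empty and both sides are 0.\<close>

lemma norm_root_avg_power2_le: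
  fixes f :: "complex ^ 'n::finite \<Rightarrow> complex"
  shows "(norm (root_avg k f z))\<^sup>2 \<le> root_avg k (\<lambda>z. (norm (f z))\<^sup>2) z"
proof -
  let ?R = "root_index k :: ('n \<Rightarrow> nat) set"
  let ?N = "real (card ?R)"
  have "(norm (\<Sum>r\<in>?R. f (inv_root k r z)))\<^sup>2 \<le> (\<Sum>r\<in>?R. norm (f (inv_root k r z)))\<^sup>2"
    by (intro power_mono norm_sum) simp
  also have "\<dots> \<le> ?N * (\<Sum>r\<in>?R. (norm (f (inv_root k r z)))\<^sup>2)"
    using sum_squared_le_sum_of_squares[of "\<lambda>r. norm (f (inv_root k r z))" ?R] by (simp add: mult.commute)
  finally have "(norm (\<Sum>r\<in>?R. f (inv_root k r z)))\<^sup>2 / ?N\<^sup>2 \<le> ?N * (\<Sum>r\<in>?R. (norm (f (inv_root k r z)))\<^sup>2) / ?N\<^sup>2"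
    by (rule divide_right_mono) simp
  then show ?thesis
    by (simp add: root_avg_def norm_divide power_divide power2_eq_square divide_simps split: if_splits)
qed

lemma borel_measurable_root_avg [measurable]:
  fixes f :: "complex ^ 'n::finite \<Rightarrow> complex"
  assumes [measurable]: "f \<in> borel_measurable haar"
  shows "root_avg k f \<in> borel_measurable haar"
proof -
  have "(\<lambda>z. f (inv_root k r z)) \<in> borel_measurable haar" for r by measurable
  then show ?thesis unfolding root_avg_def by measurable
qed

lemma
  assumes k: "k > 0" and f: "sq_integrable f"
  shows sq_integrable_root_avg: "sq_integrable (root_avg k f)"
    and root_avg_contraction: "(\<integral>z. (norm (root_avg k f z))\<^sup>2 \<partial>haar) \<le> (\<integral>z. (norm (f z))\<^sup>2 \<partial>haar)"
proof -
  have [measurable]: "f \<in> borel_measurable haar" and i: "integrable haar (\<lambda>z. (norm (f z))\<^sup>2)"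
    using f by (auto simp: sq_integrable_def)
  have avg: "integrable haar (root_avg k (\<lambda>z. (norm (f z))\<^sup>2))"
    unfolding root_avg_def using root_avg_integral(1)[OF k i] by simp
  have ir: "integrable haar (\<lambda>z. (norm (root_avg k f z))\<^sup>2)"
    by (rule Bochner_Integration.integrable_bound[OF avg])
      (auto intro!: AE_I2 order_trans[OF norm_root_avg_power2_le])
  then show "sq_integrable (root_avg k f)" by (simp add: sq_integrable_def)
  have "(\<integral>z. (norm (root_avg k f z))\<^sup>2 \<partial>haar) \<le> (\<integral>z. root_avg k (\<lambda>z. (norm (f z))\<^sup>2) z \<partial>haar)"
    by (rule integral_mono[OF ir avg]) (rule norm_root_avg_power2_le)
  then show "(\<integral>z. (norm (root_avg k f z))\<^sup>2 \<partial>haar) \<le> (\<integral>z. (norm (f z))\<^sup>2 \<partial>haar)"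
    by (simp add: root_avg_integral(2)[OF k i])
qed

section \<open>The averaging operator on L^2 and its identification with V\<close>

definition root_op :: "int \<Rightarrow> 'n::finite torus_L2 \<Rightarrow> 'n torus_L2" where
  "root_op k F = abs_torus_L2 (root_avg k (rep_torus_L2 F))"

text \<open>Independence of the representative: outside a null set two representatives agree at all
  of the finitely many fibre points, by \<open>AE_inv_root\<close>.\<close>

lemma root_op_abs:
  assumes k: "k > 0" and f: "sq_integrable f"
  shows "root_op k (abs_torus_L2 f) = abs_torus_L2 (root_avg k f)"
  unfolding root_op_def
proof (rule abs_torus_L2_eqI)
  let ?g = "rep_torus_L2 (abs_torus_L2 f)"
  show "sq_integrable (root_avg k ?g)" "sq_integrable (root_avg k f)"
    using rep_abs_torus_L2[OF f] f sq_integrable_root_avg[OF k] by auto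
  have "AE z in haar. \<forall>r\<in>root_index k. ?g (inv_root k r z) = f (inv_root k r z)"
    using AE_inv_root[OF k rep_abs_torus_L2(2)[OF f]] by (intro AE_finite_allI) auto
  then show "AE z in haar. root_avg k ?g z = root_avg k f z"
    by eventually_elim (simp add: root_avg_def)
qed

lemma bounded_clinear_L2_root_op:
  assumes "k > 0" shows "bounded_clinear_L2 (root_op k)"
proof (rule bounded_clinear_L2I[where A = "root_avg k" and C = 1])
  show "root_avg k (\<lambda>z. f z + g z) z = root_avg k f z + root_avg k g z"
    for f g :: "complex ^ 'a \<Rightarrow> complex" and z
    by (simp add: root_avg_def sum.distrib scaleR_add_right)
  show "root_avg k (\<lambda>z. c * f z) z = c * root_avg k f z" for c and f :: "complex ^ 'a \<Rightarrow> complex" and z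
    by (simp add: root_avg_def flip: sum_distrib_left)
qed (use assms in \<open>simp_all add: root_op_abs sq_integrable_root_avg root_avg_contraction\<close>)

lemma root_op_ebasis:
  assumes k: "k > 0"
  shows "root_op k (ebasis m) = (if \<forall>j. k dvd m $ j then ebasis (\<chi> j. - (m $ j div k)) else 0)"
proof -
  have "root_op k (ebasis m) = abs_torus_L2 (root_avg k (torus_char m))"
    by (simp add: ebasis_eq root_op_abs k sq_integrable_torus_char)
  also have "\<dots> = abs_torus_L2 (\<lambda>z. if \<forall>j. k dvd m $ j then torus_char (\<chi> j. - (m $ j div k)) z else 0)"
  proof (rule abs_torus_L2_eqI)
    have "sq_integrable (\<lambda>z. if b then torus_char l z else 0)" for b l
      by (cases b) (simp_all add: sq_integrable_torus_char sq_integrable_zero)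
    then show "sq_integrable (\<lambda>z. if \<forall>j. k dvd m $ j then torus_char (\<chi> j. - (m $ j div k)) z else 0)" .
    show "sq_integrable (root_avg k (torus_char m))"
      by (intro sq_integrable_root_avg k sq_integrable_torus_char)
  qed (rule AE_I2, simp only: root_avg_torus_char[OF k] space_haar)
  also have "abs_torus_L2 (\<lambda>z. if b then torus_char l z else 0) = (if b then ebasis l else 0)" for b l
    by (cases b) (simp_all add: ebasis_eq zero_torus_L2.abs_eq)
  finally show ?thesis .
qed

text \<open>Existence for the definite description comes from the values on characters, uniqueness
  from their totality.\<close>

lemma slant_V_eq:
  assumes k: "k > 0" shows "slant_V k = root_op k"
  unfolding slant_V_def
proof (rule the_equality)
  show "bounded_clinear_L2 (root_op k) \<and> (\<forall>m. root_op k (ebasis m) =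
      (if \<forall>j. k dvd m $ j then ebasis (\<chi> j. - (m $ j div k)) else 0))"
    using k by (simp add: bounded_clinear_L2_root_op root_op_ebasis)
next
  fix V :: "'a torus_L2 \<Rightarrow> 'a torus_L2"
  assume V: "bounded_clinear_L2 V \<and> (\<forall>m. V (ebasis m) =
      (if \<forall>j. k dvd m $ j then ebasis (\<chi> j. - (m $ j div k)) else 0))"
  show "V = root_op k"
    by (rule bounded_clinear_L2_eqI)
      (use V k in \<open>auto simp only: bounded_clinear_L2_root_op root_op_ebasis simp_thms\<close>)
qed

lemma root_op_mult_char:
  assumes k: "k > 0"
  shows "root_op k (mult_op (torus_char (- k *s l)) F) = mult_op (torus_char l) (root_op k F)"
proof -
  obtain f where f: "sq_integrable f" and F: "F = abs_torus_L2 f" by (rule torus_L2_cases)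
  note sq = Linf_sq_integrable_mult[OF torus_char_Linf]
  have "abs_torus_L2 (root_avg k (\<lambda>z. torus_char (- k *s l) z * f z)) = abs_torus_L2 (\<lambda>z. torus_char l z * root_avg k f z)"
  proof (rule abs_torus_L2_eqI)
    show "AE z in haar. root_avg k (\<lambda>z. torus_char (- k *s l) z * f z) z = torus_char l z * root_avg k f z"
      using root_avg_mult[OF k, where g = "torus_char l"] by (auto simp: torus_char_inv_power)
  qed (intro sq_integrable_root_avg k sq f)+
  then show ?thesis
    by (simp add: F mult_op_abs torus_char_Linf f k sq sq_integrable_root_avg root_op_abs)
qed

lemma mult_op_commute:
  assumes "\<phi> \<in> Linf" "\<psi> \<in> Linf"
  shows "mult_op \<phi> (mult_op \<psi> F) = mult_op \<psi> (mult_op \<phi> F)"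
proof -
  obtain f where f: "sq_integrable f" and F: "F = abs_torus_L2 f" by (rule torus_L2_cases)
  show ?thesis
    using assms f by (simp add: F mult_op_abs Linf_sq_integrable_mult mult.left_commute)
qed

section \<open>Composition with the inverse power map\<close>

lemma integral_inv_power:
  fixes u :: "complex ^ 'n::finite \<Rightarrow> 'b::{banach, second_countable_topology}"
  assumes k: "k \<noteq> 0" and u: "integrable haar u"
  shows "integrable haar (\<lambda>z. u (inv_power k z))" "(\<integral>z. u (inv_power k z) \<partial>haar) = (\<integral>z. u z \<partial>haar)"
proof -
  have "integrable (distr haar haar (inv_power k)) u" unfolding distr_inv_power[OF k] by (rule u)
  then show "integrable haar (\<lambda>z. u (inv_power k z))"
    by (rule integrable_distr[OF measurable_inv_power])
  have "(\<integral>z. u z \<partial>haar) = (\<integral>z. u z \<partial>distr haar haar (inv_power k))"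
    by (simp only: distr_inv_power[OF k])
  also have "\<dots> = (\<integral>z. u (inv_power k z) \<partial>haar)"
    by (rule integral_distr[OF measurable_inv_power borel_measurable_integrable[OF u]])
  finally show "(\<integral>z. u (inv_power k z) \<partial>haar) = (\<integral>z. u z \<partial>haar)" ..
qed

lemma AE_inv_power:
  assumes k: "k \<noteq> 0" and "AE z in haar. Q z"
  shows "AE z in haar. Q (inv_power k z)"
proof -
  have "AE z in distr haar haar (inv_power k). Q z" unfolding distr_inv_power[OF k] by fact
  then show ?thesis by (rule AE_distrD[OF measurable_inv_power])
qed

lemma sq_integrable_inv_power:
  assumes k: "k \<noteq> 0" and f: "sq_integrable f"
  shows "sq_integrable (\<lambda>z. f (inv_power k z))"
proof -
  have [measurable]: "f \<in> borel_measurable haar" and i: "integrable haar (\<lambda>z. (norm (f z))\<^sup>2)"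
    using f by (auto simp: sq_integrable_def)
  show ?thesis unfolding sq_integrable_def using integral_inv_power(1)[OF k i] by simp
qed

text \<open>The composition operator sending \<open>F\<close> to \<open>F \<circ> p\<close>; for
  positive \<open>k\<close> it is the adjoint of V.\<close>

definition power_op :: "int \<Rightarrow> 'n::finite torus_L2 \<Rightarrow> 'n torus_L2" where
  "power_op k F = abs_torus_L2 (\<lambda>z. rep_torus_L2 F (inv_power k z))"

lemma power_op_abs:
  assumes k: "k \<noteq> 0" and f: "sq_integrable f"
  shows "power_op k (abs_torus_L2 f) = abs_torus_L2 (\<lambda>z. f (inv_power k z))"
  unfolding power_op_def
  by (intro abs_torus_L2_eqI AE_inv_power[OF k, where Q = "\<lambda>z. rep_torus_L2 (abs_torus_L2 f) z = f z"]
      sq_integrable_inv_power k f rep_abs_torus_L2)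

lemma bounded_clinear_L2_power_op:
  assumes k: "k \<noteq> 0" shows "bounded_clinear_L2 (power_op k)"
proof (rule bounded_clinear_L2I[where A = "\<lambda>f z. f (inv_power k z)" and C = 1])
  fix f assume "sq_integrable f"
  then have "integrable haar (\<lambda>z. (norm (f z))\<^sup>2)" by (simp add: sq_integrable_def)
  from integral_inv_power(2)[OF k this]
  show "(\<integral>z. (norm (f (inv_power k z)))\<^sup>2 \<partial>haar) \<le> 1\<^sup>2 * (\<integral>z. (norm (f z))\<^sup>2 \<partial>haar)" by simp
qed (simp_all add: power_op_abs sq_integrable_inv_power k)

lemma power_op_ebasis: "k \<noteq> 0 \<Longrightarrow> power_op k (ebasis m) = ebasis (- k *s m)"
  by (simp add: ebasis_eq power_op_abs sq_integrable_torus_char torus_char_inv_power)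

section \<open>Closure properties of bounded functions and a boundedness criterion\<close>

lemma Linf_sum: "(\<And>i. i \<in> I \<Longrightarrow> f i \<in> Linf) \<Longrightarrow> (\<lambda>z. \<Sum>i\<in>I. f i z) \<in> Linf"
proof (induction I rule: infinite_finite_induct)
  case (insert i I)
  then obtain C D where C: "AE z in haar. norm (f i z) \<le> C" and D: "AE z in haar. norm (\<Sum>i\<in>I. f i z) \<le> D"
    by (fastforce simp: Linf_def)
  have "AE z in haar. norm (f i z + (\<Sum>i\<in>I. f i z)) \<le> C + D"
    using C D by eventually_elim (rule norm_triangle_le, simp)
  moreover have "(\<lambda>z. f i z + (\<Sum>i\<in>I. f i z)) \<in> borel_measurable haar"
    using insert by (intro borel_measurable_add) (auto simp: Linf_def)
  ultimately show ?case using insert by (auto simp: Linf_def)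
qed (auto simp: Linf_def)

lemma Linf_mult: "f \<in> Linf \<Longrightarrow> g \<in> Linf \<Longrightarrow> (\<lambda>z. f z * g z) \<in> Linf"
proof -
  assume f: "f \<in> Linf" and g: "g \<in> Linf"
  then obtain C D where C: "AE z in haar. norm (f z) \<le> C" and D: "AE z in haar. norm (g z) \<le> D"
    by (auto simp: Linf_def)
  have "AE z in haar. norm (f z * g z) \<le> \<bar>C\<bar> * \<bar>D\<bar>"
    using C D by eventually_elim (auto simp: norm_mult intro!: mult_mono)
  then show ?thesis using f g by (auto simp: Linf_def)
qed

lemma Linf_inv_power: "k \<noteq> 0 \<Longrightarrow> f \<in> Linf \<Longrightarrow> (\<lambda>z. f (inv_power k z)) \<in> Linf"
proof -
  assume k: "k \<noteq> 0" and f: "f \<in> Linf"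
  then obtain C where "AE z in haar. norm (f z) \<le> C" by (auto simp: Linf_def)
  from AE_inv_power[OF k this] f show ?thesis by (auto simp: Linf_def)
qed

text \<open>Tested on the set \<open>A\<close> where \<open>norm (f z)\<close> exceeds
  \<open>K\<close>, the hypothesis makes the integral over \<open>A\<close> of the positive function
  \<open>(norm (f z))\<^sup>2 - K\<^sup>2\<close> at most 0, so \<open>A\<close> is a null
  set.\<close>

lemma Linf_if_local_bound:
  fixes f :: "complex ^ 'n::finite \<Rightarrow> complex"
  assumes f: "sq_integrable f" and K: "0 \<le> K"
    and bound: "\<And>A. A \<in> sets haar \<Longrightarrow> (\<integral>z. (norm (indicator A z * f z))\<^sup>2 \<partial>haar) \<le> K\<^sup>2 * measure haar A"
  shows "f \<in> Linf"
proof -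
  have [measurable]: "f \<in> borel_measurable haar" and i: "integrable haar (\<lambda>z. (norm (f z))\<^sup>2)"
    using f by (auto simp: sq_integrable_def)
  define A where "A = {z \<in> space haar. K < norm (f z)}"
  have A [measurable]: "A \<in> sets haar" unfolding A_def by measurable
  have iA: "integrable haar (\<lambda>z. indicator A z * (norm (f z))\<^sup>2)" "integrable haar (\<lambda>z. indicator A z * K\<^sup>2)"
    using integrable_real_mult_indicator[OF A i] integrable_real_mult_indicator[OF A, of "\<lambda>_. K\<^sup>2"]
    by (simp_all add: mult.commute)
  have eq: "(norm (indicator A z * f z))\<^sup>2 = indicator A z * (norm (f z))\<^sup>2" for z
    by (simp add: indicator_def)
  have le: "K\<^sup>2 \<le> (norm (f z))\<^sup>2" if "z \<in> A" for z
    using that K by (intro power_mono) (auto simp: A_def)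
  have "(\<integral>z. indicator A z * (norm (f z))\<^sup>2 - indicator A z * K\<^sup>2 \<partial>haar) \<le> 0"
  proof -
    have "(\<integral>z. indicator A z * K\<^sup>2 \<partial>haar) = K\<^sup>2 * measure haar A"
      using sets.sets_into_space[OF A] by (simp add: Int_absorb2)
    then show ?thesis
      using bound[OF A] unfolding Bochner_Integration.integral_diff[OF iA] eq by linarith
  qed
  moreover have "(\<integral>z. indicator A z * (norm (f z))\<^sup>2 - indicator A z * K\<^sup>2 \<partial>haar) \<ge> 0"
    using le by (intro integral_nonneg_AE AE_I2) (auto simp: indicator_def)
  ultimately have "(\<integral>z. indicator A z * (norm (f z))\<^sup>2 - indicator A z * K\<^sup>2 \<partial>haar) = 0" by linarith
  then have "AE z in haar. indicator A z * (norm (f z))\<^sup>2 - indicator A z * K\<^sup>2 = 0"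
    using le iA by (subst (asm) integral_nonneg_eq_0_iff_AE) (auto simp: indicator_def intro!: AE_I2)
  then have "AE z in haar. norm (f z) \<le> K"
  proof (rule AE_mp, intro AE_I2 impI)
    fix z assume z: "z \<in> space haar" and 0: "indicator A z * (norm (f z))\<^sup>2 - indicator A z * K\<^sup>2 = 0"
    show "norm (f z) \<le> K"
    proof (rule ccontr)
      assume "\<not> norm (f z) \<le> K"
      moreover from this have "K\<^sup>2 < (norm (f z))\<^sup>2" using K by (intro power_strict_mono) auto
      ultimately show False using z 0 by (simp add: A_def)
    qed
  qed
  then show ?thesis by (auto simp: Linf_def)
qed

text \<open>The unit vectors generate the group of integer vectors; this turns a relation for unit
  shifts into one for all shifts.\<close>

lemma int_vec_induct:
  fixes v :: "int ^ 'n::finite"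
  assumes 0: "P 0" and axis: "\<And>j. P (axis j 1)"
    and add: "\<And>u v. P u \<Longrightarrow> P v \<Longrightarrow> P (u + v)" and uminus: "\<And>u. P u \<Longrightarrow> P (- u)"
  shows "P v"
proof -
  have nat: "P (int n *s axis j 1)" for n j
    by (induction n) (auto simp: 0 vector_sadd_rdistrib intro: add axis)
  have "P (a *s axis j 1)" for a j
  proof (cases "a \<ge> 0")
    case True then show ?thesis using nat[of "nat a" j] by simp
  next
    case False
    then have "- (int (nat (- a)) *s axis j 1) = a *s (axis j 1 :: int ^ 'n)" by (simp add: vec_eq_iff)
    then show ?thesis using uminus[OF nat[of "nat (- a)" j]] by simp
  qed
  then have "P (\<Sum>j\<in>J. v $ j *s axis j 1)" for J
    by (induction J rule: infinite_finite_induct) (auto intro: 0 add)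
  from this[of UNIV] show ?thesis by (simp only: basis_expansion)
qed

section \<open>The relation characterizing slant Hankel operators\<close>

text \<open>Multiplication by the character \<open>- k *s l\<close> commutes with that by
  \<open>\<phi>\<close> and passes through V as the character \<open>l\<close>; being unitary, the
  latter cancels in the pairing.\<close>

lemma slant_hankel_relation:
  fixes \<phi> :: "complex ^ 'n::finite \<Rightarrow> complex"
  assumes k: "k > 0" and \<phi>: "\<phi> \<in> Linf"
  shows "L2_cinner (slant_hankel k \<phi> (ebasis (m - k *s l))) (ebasis (m' + l)) =
    L2_cinner (slant_hankel k \<phi> (ebasis m)) (ebasis m')"
proof -
  have "mult_op \<phi> (ebasis (m - k *s l)) = mult_op \<phi> (mult_op (torus_char (- k *s l)) (ebasis m))"
  proof -
    have "- k *s l + m = m - k *s l" by (simp add: vec_eq_iff)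
    then show ?thesis by (simp only: mult_op_char_ebasis)
  qed
  also have "\<dots> = mult_op (torus_char (- k *s l)) (mult_op \<phi> (ebasis m))"
    by (rule mult_op_commute[OF \<phi> torus_char_Linf])
  finally have "slant_hankel k \<phi> (ebasis (m - k *s l)) = mult_op (torus_char l) (slant_hankel k \<phi> (ebasis m))"
    using root_op_mult_char[OF k] by (simp add: slant_hankel_def slant_V_eq[OF k])
  moreover have "ebasis (m' + l) = mult_op (torus_char l) (ebasis m')"
    by (simp add: mult_op_char_ebasis add.commute)
  ultimately show ?thesis by (simp add: L2_cinner_mult_op_char)
qed

text \<open>The relation among matrix entries becomes an identity of vectors, since a vector is
  determined by its Fourier coefficients.\<close>

lemma slant_relation_shift:
  fixes S :: "'n::finite torus_L2 \<Rightarrow> 'n torus_L2"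
  assumes rel: "\<And>m m' j. L2_cinner (S (ebasis (m - k *s axis j 1))) (ebasis (m' + axis j 1)) =
      L2_cinner (S (ebasis m)) (ebasis m')"
  shows "S (ebasis (m - k *s l)) = mult_op (torus_char l) (S (ebasis m))"
proof -
  \<comment> \<open>Both indices stay quantified: a sum of shifts uses the hypothesis at shifted
    indices, and a negated shift uses it at the target indices.\<close>
  have "\<forall>m m'. L2_cinner (S (ebasis (m - k *s l))) (ebasis (m' + l)) = L2_cinner (S (ebasis m)) (ebasis m')"
  proof (induction l rule: int_vec_induct)
    case (3 u v)
    have "m - k *s (u + v) = m - k *s u - k *s v" "m' + (u + v) = m' + u + v" for m m' :: "int ^ 'n"
      by (simp_all add: vector_add_ldistrib algebra_simps)
    then show ?case using 3 by (simp only: simp_thms)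
  next
    case (4 u)
    show ?case
    proof (intro allI)
      fix m m'
      show "L2_cinner (S (ebasis (m - k *s - u))) (ebasis (m' + - u)) = L2_cinner (S (ebasis m)) (ebasis m')"
        using 4[rule_format, of "m - k *s - u" "m' + - u"] by (simp add: vec_eq_iff)
    qed
  qed (simp_all add: rel)
  then have eq: "L2_cinner (S (ebasis (m - k *s l))) (ebasis (m' + l)) = L2_cinner (S (ebasis m)) (ebasis m')" for m'
    by blast
  show ?thesis
  proof (rule L2_eqI)
    fix m''
    have "L2_cinner (S (ebasis (m - k *s l))) (ebasis m'') = L2_cinner (S (ebasis m)) (ebasis (m'' - l))"
      using eq[of "m'' - l"] by simp
    also have "\<dots> = L2_cinner (mult_op (torus_char l) (S (ebasis m))) (mult_op (torus_char l) (ebasis (m'' - l)))"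
      by (simp add: L2_cinner_mult_op_char)
    finally show "L2_cinner (S (ebasis (m - k *s l))) (ebasis m'') =
        L2_cinner (mult_op (torus_char l) (S (ebasis m))) (ebasis m'')"
      by (simp add: mult_op_char_ebasis)
  qed
qed

text \<open>On characters \<open>T\<close> multiplies by \<open>\<psi>\<close>. Once this is known
  for indicators, the bound of \<open>S\<close> restricts \<open>\<psi>\<close> on every measurable
  set, as \<open>Linf_if_local_bound\<close> requires.\<close>

lemma slant_relation_symbol_bounded:
  fixes S :: "'n::finite torus_L2 \<Rightarrow> 'n torus_L2"
  assumes k: "k \<noteq> 0" and S: "bounded_clinear_L2 S"
    and shift: "\<And>m l. S (ebasis (m - k *s l)) = mult_op (torus_char l) (S (ebasis m))"
    and \<psi>: "sq_integrable \<psi>" "S (ebasis i) = abs_torus_L2 \<psi>"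
  shows "\<psi> \<in> Linf"
proof -
  define T where "T F = S (mult_op (torus_char i) (power_op k F))" for F
  have T: "bounded_clinear_L2 T"
    unfolding T_def
    by (intro bounded_clinear_L2_compose[OF S] bounded_clinear_L2_compose[OF bounded_clinear_L2_mult_op]
        torus_char_Linf bounded_clinear_L2_power_op k)
  interpret T: bounded_linear T using T by (simp add: bounded_clinear_L2_def)
  interpret S: bounded_linear S using S by (simp add: bounded_clinear_L2_def)
  have [measurable]: "\<psi> \<in> borel_measurable haar" using \<psi> by (simp add: sq_integrable_def)
  have [measurable]: "(\<lambda>z. cnj (\<psi> z)) \<in> borel_measurable haar"
    by (rule borel_measurable_continuous_on[OF continuous_on_cnj[OF continuous_on_id]]) measurable
  have "sq_integrable (\<lambda>z. cnj (\<psi> z))" using \<psi>(1) by (simp add: sq_integrable_def)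
  then have sq: "sq_integrable (\<lambda>z. torus_char m z * cnj (\<psi> z))" for m
    by (rule Linf_sq_integrable_mult[OF torus_char_Linf])
  \<comment> \<open>Moving \<open>\<psi>\<close> to the other side of the pairing makes both sides
    continuous in \<open>F\<close> with \<open>\<psi>\<close> only square integrable, so totality of
    the characters applies.\<close>
  have "{F. L2_cinner (T F) (ebasis m) = L2_cinner F (abs_torus_L2 (\<lambda>z. torus_char m z * cnj (\<psi> z)))} = UNIV" (is "?M = _") for m
  proof (rule ebasis_total)
    have "continuous_on UNIV (\<lambda>F. L2_cinner (T F) (ebasis m))"
      by (rule continuous_on_compose2[OF continuous_on_L2_cinner_left linear_continuous_on])
        (auto intro: T.bounded_linear_axioms)
    then show "closed ?M" by (intro closed_Collect_eq continuous_on_L2_cinner_left)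
    show "subspace ?M"
      by (auto simp: subspace_def T.zero T.add L2_cinner_add_left L2_cinner_scaleC bounded_clinear_L2_scaleC[OF T]
          simp flip: L2_scaleC_of_real)
    fix c l
    have "i + - k *s l = i - k *s l" by (simp add: vec_eq_iff)
    then have "T (ebasis l) = S (ebasis (i - k *s l))"
      by (simp only: T_def power_op_ebasis[OF k] mult_op_char_ebasis)
    also have "\<dots> = abs_torus_L2 (\<lambda>z. torus_char l z * \<psi> z)"
      by (simp add: shift \<psi> mult_op_abs torus_char_Linf)
    finally have "L2_cinner (T (ebasis l)) (ebasis m) = L2_cinner (ebasis l) (abs_torus_L2 (\<lambda>z. torus_char m z * cnj (\<psi> z)))"
      by (simp add: ebasis_eq L2_cinner_abs sq sq_integrable_torus_char Linf_sq_integrable_mult torus_char_Linf \<psi>)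
        (simp add: mult_ac)
    then show "L2_scaleC c (ebasis l) \<in> ?M"
      by (simp add: bounded_clinear_L2_scaleC[OF T] L2_cinner_scaleC)
  qed
  then have adj: "L2_cinner (T F) (ebasis m) = L2_cinner F (abs_torus_L2 (\<lambda>z. torus_char m z * cnj (\<psi> z)))" for F m
    by blast
  obtain K where K: "K \<ge> 0" "\<And>F. norm (S F) \<le> norm F * K" using S.nonneg_bounded by blast
  show ?thesis
  proof (rule Linf_if_local_bound[OF \<psi>(1) K(1)])
    fix A :: "(complex ^ 'n) set" assume A [measurable]: "A \<in> sets haar"
    have ind: "sq_integrable (\<lambda>z. indicator A z)"
      by (rule sq_integrable_bounded[where B = 1]) (auto simp: indicator_def)
    have ind\<psi>: "sq_integrable (\<lambda>z. indicator A z * \<psi> z)"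
      by (rule sq_integrable_bounded_mult[OF \<psi>(1), where C = 1]) (auto simp: indicator_def)
    \<comment> \<open>\<open>T\<close> of the indicator is \<open>S ?G\<close>. The character has
      modulus 1 and the power map preserves Haar measure, so \<open>?G\<close> has the same norm as
      the indicator and the bound \<open>K\<close> of \<open>S\<close> carries over.\<close>
    let ?G = "mult_op (torus_char i) (power_op k (abs_torus_L2 (\<lambda>z. indicator A z)))"
    have "T (abs_torus_L2 (\<lambda>z. indicator A z)) = abs_torus_L2 (\<lambda>z. indicator A z * \<psi> z)"
    proof (rule L2_eqI)
      fix m
      show "L2_cinner (T (abs_torus_L2 (\<lambda>z. indicator A z))) (ebasis m) =
          L2_cinner (abs_torus_L2 (\<lambda>z. indicator A z * \<psi> z)) (ebasis m)"
        unfolding adj unfolding ebasis_eq L2_cinner_abs[OF ind sq] L2_cinner_abs[OF ind\<psi> sq_integrable_torus_char]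
        by (simp add: mult_ac)
    qed
    then have "norm (abs_torus_L2 (\<lambda>z. indicator A z * \<psi> z)) \<le> norm ?G * K"
      using K(2)[of ?G] by (simp add: T_def)
    then have "(norm (abs_torus_L2 (\<lambda>z. indicator A z * \<psi> z)))\<^sup>2 \<le> (norm ?G * K)\<^sup>2"
      by (intro power_mono) auto
    moreover have "(norm ?G)\<^sup>2 = measure haar A"
    proof -
      have i: "integrable haar (indicator A :: _ \<Rightarrow> real)"
        by (rule integrable_real_indicator[OF A]) (simp add: haar.emeasure_eq_measure)
      have "(norm ?G)\<^sup>2 = (\<integral>z. (norm (torus_char i z * indicator A (inv_power k z)))\<^sup>2 \<partial>haar)"
        using sq_integrable_inv_power[OF k ind]
        by (simp add: power_op_abs k ind mult_op_abs torus_char_Linf norm_abs_torus_L2_power2 Linf_sq_integrable_mult)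
      also have "\<dots> = (\<integral>z. indicator A (inv_power k z) \<partial>haar)"
        by (rule Bochner_Integration.integral_cong) (auto simp: norm_mult indicator_def)
      also have "\<dots> = measure haar A"
        using integral_inv_power(2)[OF k i] sets.sets_into_space[OF A] by (simp add: Int_absorb2)
      finally show ?thesis .
    qed
    ultimately show "(\<integral>z. (norm (indicator A z * \<psi> z))\<^sup>2 \<partial>haar) \<le> K\<^sup>2 * measure haar A"
      by (simp add: norm_abs_torus_L2_power2[OF ind\<psi>] power_mult_distrib) (simp add: mult.commute)
  qed
qed

text \<open>Averaging the term for \<open>r\<close> of \<open>\<phi>\<close> times the character
  \<open>m\<close> gives \<open>\<psi> r\<close> times the average of the character
  \<open>m - v r\<close>. This vanishes unless \<open>v r\<close> is the residue of
  \<open>m\<close>, and \<open>shift\<close> carries the surviving term from the residue to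
  \<open>m\<close>.\<close>

lemma is_slant_hankel_if_shift:
  fixes S :: "'n::finite torus_L2 \<Rightarrow> 'n torus_L2"
  assumes k: "k > 0" and S: "bounded_clinear_L2 S"
    and shift: "\<And>m l. S (ebasis (m - k *s l)) = mult_op (torus_char l) (S (ebasis m))"
  shows "is_slant_hankel k S"
proof -
  let ?R = "root_index k :: ('n \<Rightarrow> nat) set"
  \<comment> \<open>The exponents that index the roots of unity also serve as representatives of the
    residues modulo \<open>k\<close>.\<close>
  define v :: "('n \<Rightarrow> nat) \<Rightarrow> int ^ 'n" where "v r = (\<chi> j. int (r j))" for r
  have "\<exists>\<psi>. sq_integrable \<psi> \<and> S (ebasis (v r)) = abs_torus_L2 \<psi>" for r
    using torus_L2_cases by metis
  then obtain \<psi> where \<psi>: "\<And>r. sq_integrable (\<psi> r)" "\<And>r. S (ebasis (v r)) = abs_torus_L2 (\<psi> r)" by metis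
  have Linf: "\<psi> r \<in> Linf" for r
    using slant_relation_symbol_bounded[OF _ S shift \<psi>] k by simp
  define \<phi> where "\<phi> z = (\<Sum>r\<in>?R. torus_char (- v r) z * \<psi> r (inv_power k z))" for z
  have \<phi>: "\<phi> \<in> Linf"
    unfolding \<phi>_def[abs_def] using k by (intro Linf_sum Linf_mult torus_char_Linf Linf_inv_power Linf) auto
  have "root_op k (mult_op \<phi> (ebasis m)) = S (ebasis m)" for m
  proof -
    \<comment> \<open>For positive \<open>k\<close> the remainder is nonnegative even at negative
      entries, so \<open>nat\<close> loses nothing; \<open>l\<close> is the matching
      quotient.\<close>
    define r0 where "r0 = (\<lambda>j. nat (m $ j mod k))"
    define l :: "int ^ 'n" where "l = (\<chi> j. m $ j div k)"
    have r0: "r0 \<in> ?R" using k by (auto simp: r0_def root_index_def nat_less_iff)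
    have m: "v r0 - k *s (- l) = m"
      using k by (simp add: vec_eq_iff v_def r0_def l_def)
    have diff: "(m - v r0) $ j = k * (m $ j div k)" for j
      using k by (simp add: v_def r0_def minus_mod_eq_mult_div)
    have iff: "(\<forall>j. k dvd (m - v r) $ j) \<longleftrightarrow> r = r0" if "r \<in> ?R" for r
    proof
      assume d: "\<forall>j. k dvd (m - v r) $ j"
      show "r = r0"
      proof
        fix j
        have "r j < nat k" using that by (auto simp: root_index_def)
        then have "int (r j) mod k = int (r j)" by simp
        moreover have "m $ j mod k = int (r j) mod k" using d by (simp add: v_def mod_eq_dvd_iff)
        ultimately show "r j = r0 j" by (simp add: r0_def)
      qed
    next
      assume "r = r0"
      then show "\<forall>j. k dvd (m - v r) $ j" by (simp only: diff) simp
    qed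
    have l: "(\<chi> j. - ((m - v r0) $ j div k)) = - l"
      unfolding diff using k by (simp add: vec_eq_iff l_def)
    have avg: "root_avg k (\<lambda>z. \<phi> z * torus_char m z) z = torus_char (- l) z * \<psi> r0 z" if z: "z \<in> torus" for z
    proof -
      have "root_avg k (\<lambda>z. \<phi> z * torus_char m z) z =
          root_avg k (\<lambda>z. \<Sum>r\<in>?R. \<psi> r (inv_power k z) * torus_char (m - v r) z) z"
      proof -
        have "\<phi> w * torus_char m w = (\<Sum>r\<in>?R. \<psi> r (inv_power k w) * torus_char (m - v r) w)"
          if w: "w \<in> torus" for w
          unfolding \<phi>_def sum_distrib_right
        proof (rule sum.cong[OF refl])
          fix r
          have "torus_char (m - v r) w = torus_char m w * torus_char (- v r) w"
            using torus_char_add[OF w, of m "- v r"] by simp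
          then show "torus_char (- v r) w * \<psi> r (inv_power k w) * torus_char m w =
              \<psi> r (inv_power k w) * torus_char (m - v r) w"
            by (simp only: mult_ac)
        qed
        then show ?thesis unfolding root_avg_def using z by simp
      qed
      also have "\<dots> = (\<Sum>r\<in>?R. root_avg k (\<lambda>z. \<psi> r (inv_power k z) * torus_char (m - v r) z) z)"
        unfolding root_avg_def scaleR_sum_right by (rule sum.swap)
      also have "\<dots> = (\<Sum>r\<in>?R. \<psi> r z * root_avg k (torus_char (m - v r)) z)"
        by (simp add: root_avg_mult[OF k z])
      also have "\<dots> = (\<Sum>r\<in>?R. if r = r0 then \<psi> r0 z * torus_char (- l) z else 0)"
      proof (rule sum.cong[OF refl])
        fix r assume r: "r \<in> ?R"
        show "\<psi> r z * root_avg k (torus_char (m - v r)) z = (if r = r0 then \<psi> r0 z * torus_char (- l) z else 0)"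
          unfolding root_avg_torus_char[OF k z] iff[OF r]
        proof (cases "r = r0")
          case True
          show "\<psi> r z * (if r = r0 then torus_char (\<chi> j. - ((m - v r) $ j div k)) z else 0) =
              (if r = r0 then \<psi> r0 z * torus_char (- l) z else 0)"
            unfolding True l by (simp only: if_True refl)
        next
          case False
          show "\<psi> r z * (if r = r0 then torus_char (\<chi> j. - ((m - v r) $ j div k)) z else 0) =
              (if r = r0 then \<psi> r0 z * torus_char (- l) z else 0)"
            by (simp only: False if_False mult_zero_right)
        qed
      qed
      finally show ?thesis using r0 by (simp add: mult.commute)
    qed
    have "root_op k (mult_op \<phi> (ebasis m)) = abs_torus_L2 (root_avg k (\<lambda>z. \<phi> z * torus_char m z))"
      by (simp add: ebasis_eq mult_op_abs root_op_abs \<phi> k sq_integrable_torus_char Linf_sq_integrable_mult)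
    also have "\<dots> = abs_torus_L2 (\<lambda>z. torus_char (- l) z * \<psi> r0 z)"
      by (intro abs_torus_L2_eqI sq_integrable_root_avg k Linf_sq_integrable_mult \<phi> sq_integrable_torus_char
          torus_char_Linf \<psi> AE_I2) (simp add: avg)
    also have "\<dots> = mult_op (torus_char (- l)) (S (ebasis (v r0)))"
      by (simp add: \<psi> mult_op_abs torus_char_Linf)
    also have "\<dots> = S (ebasis m)" unfolding shift[symmetric] m ..
    finally show ?thesis .
  qed
  \<comment> \<open>Agreement on characters suffices because both operators are bounded; for the
    right side this uses \<open>\<phi> \<in> Linf\<close>.\<close>
  then have "S = (\<lambda>F. root_op k (mult_op \<phi> F))"
    by (intro bounded_clinear_L2_eqI[OF S bounded_clinear_L2_compose[OF bounded_clinear_L2_root_op[OF k]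
        bounded_clinear_L2_mult_op[OF \<phi>]]]) simp
  then show ?thesis
    using \<phi> by (auto simp: is_slant_hankel_def slant_hankel_def slant_V_eq[OF k] comp_def)
qed

theorem theorem2p3:
  fixes k :: int and S :: "'n::finite torus_L2 \<Rightarrow> 'n torus_L2"
  assumes "k \<ge> 2" and "bounded_clinear_L2 S"
  shows "is_slant_hankel k S \<longleftrightarrow>
    (\<forall>m m' :: int ^ 'n. \<forall>j.
       L2_cinner (S (ebasis (m - k *s axis j 1))) (ebasis (m' + axis j 1)) = L2_cinner (S (ebasis m)) (ebasis m'))"
proof
  assume "is_slant_hankel k S"
  then obtain \<phi> where "\<phi> \<in> Linf" "S = slant_hankel k \<phi>" by (auto simp: is_slant_hankel_def)
  then show "\<forall>m m' :: int ^ 'n. \<forall>j.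
       L2_cinner (S (ebasis (m - k *s axis j 1))) (ebasis (m' + axis j 1)) = L2_cinner (S (ebasis m)) (ebasis m')"
    using slant_hankel_relation[of k \<phi>] assms(1) by simp
next
  assume "\<forall>m m' :: int ^ 'n. \<forall>j.
       L2_cinner (S (ebasis (m - k *s axis j 1))) (ebasis (m' + axis j 1)) = L2_cinner (S (ebasis m)) (ebasis m')"
  then have "S (ebasis (m - k *s l)) = mult_op (torus_char l) (S (ebasis m))" for m l
    by (intro slant_relation_shift) simp
  then show "is_slant_hankel k S"
    using assms by (intro is_slant_hankel_if_shift) auto
qed

end
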